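(* Let $\mathbb X=(X,\tau,\mathsf d,\mathfrak m)$ be an extended metric-topological measure space, let ${\rm S}_{\mathbb X}$ be its maximal $\mathsf d$-separable component, and let $b$ be a Lipschitz derivation on $\mathbb X$. Then: (i) If $b$ is weakly$^*$-type continuous, then $b(f)=0$ holds $\mathfrak m$-a.e. on $X\setminus{\rm S}_{\mathbb X}$ for every $f\in\mathrm{Lip}_b(X,\tau,\mathsf d)$. (ii) If $b$ is a local derivation and $b\llcorner{\rm S}_{\mathbb X}$ is weakly$^*$-type sequentially continuous, then $b\llcorner{\rm S}_{\mathbb X}$ is weakly$^*$-type continuous. In particular, if $b$ is weakly$^*$-type sequentially continuous, then $b\llcorner{\rm S}_{\mathbb X}$ is weakly$^*$-type continuous.
   Context: An extended distance on a set $X$ is a symmetric function $\mathsf d\colon X\times X\to[0,+\infty]$ satisfying the triangle inequality and with $\mathsf d(x,y)=0$ iff $x=y$. For $f\colon X\to\mathbb R$ and $A\subseteq X$, $\mathrm{Lip}(f,A,\mathsf d)=\sup\{|f(x)-f(y)|/\mathsf d(x,y):x,y\in A,\ x\neq y\}$ (with $c/(+\infty)=0$, $\sup\varnothing=0$), $\mathrm{Lip}(f,\mathsf d)=\mathrm{Lip}(f,X,\mathsf d)$. $\mathrm{Lip}_b(X,\tau,\mathsf d)$ is the Banach algebra of bounded $\tau$-continuous $\mathsf d$-Lipschitz functions $f\colon X\to\mathbb R$ with norm $\mathrm{Lip}(f,\mathsf d)+\sup_X|f|$. $(X,\tau,\mathsf d)$ is an extended metric-topological space if $\tau$ is Hausdorff,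 $\mathsf d$ is an extended distance, $\tau$ is the initial topology of $\mathrm{Lip}_b(X,\tau,\mathsf d)$, and $\mathsf d(x,y)=\sup\{|f(x)-f(y)|:f\in\mathrm{Lip}_b(X,\tau,\mathsf d),\ \mathrm{Lip}(f,\mathsf d)\leq 1\}$ for all $x,y$. It becomes an extended metric-topological measure space (e.m.t.m. space) when equipped with a finite Radon (i.e. inner regular with respect to $\tau$-compact sets) measure $\mathfrak m$ on the Borel sets $\mathscr B(X,\tau)$. Maximal $\mathsf d$-separable component: ${\rm S}_{\mathbb X}\in\mathscr B(X,\tau)$ is a $\mathsf d$-separable set such that $\mathfrak m(E)=0$ for every $\mathsf d$-separable $E\in\mathscr B(X,\tau)$ with $E\subseteq X\setminus{\rm S}_{\mathbb X}$; such a set exists and is unique up to $\mathfrak m$-null sets. $L^0(\mathfrak m)$ is the algebra of real-valued $\tau$-Borel functions up to $\mathfrak m$-a.e. equality. A Lipschitz derivation on $\mathbb X$ is a linear map $b\colon\mathrm{Lip}_b(X,\tau,\mathsf d)\to L^0(\mathfrak m)$ with $b(fg)=f\,b(g)+g\,b(f)$ for all $f,g$. It is local if for every $f\in\mathrm{Lip}_b(X,\tau,\mathsf d)$ one has $b(f)=0$ $\mathfrak m$-a.e. on $\{f=0\}$. Suppose $b(f)\in L^\infty(\mathfrak m)$ for every $f$; then $b$ is weakly$^*$-type continuous (resp. weakly$^*$-type sequentially continuous) if its restriction to the closed unit ball of $\mathrm{Lip}_b(X,\tau,\mathsf d)$ is continuous (resp. sequentially continuous) from the topology of pointwise convergence to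 the weak$^*$ topology of $L^\infty(\mathfrak m)$ (these properties include the requirement that $b$ takes values in $L^\infty(\mathfrak m)$). Every weakly$^*$-type sequentially continuous derivation is local. Restriction: for $E\in\mathscr B(X,\tau)$, $\mathbb X\llcorner E=(E,\tau_E,\mathsf d|_{E\times E},\mathfrak m\llcorner E)$ with $\tau_E$ the subspace topology; it is an e.m.t.m. space. If $b$ is a local derivation on $\mathbb X$, the local derivation $b\llcorner E$ on $\mathbb X\llcorner E$ is defined as follows: choose pairwise disjoint $\tau$-compact sets $K_n\subseteq E$ with $\mathfrak m(E\setminus\bigcup_n K_n)=0$; for $f\in\mathrm{Lip}_b(E,\tau_E,\mathsf d|_{E\times E})$ choose $\bar f_n\in\mathrm{Lip}_b(X,\tau,\mathsf d)$ with $\bar f_n|_{K_n}=f|_{K_n}$ (such functions exist), and set $(b\llcorner E)(f)=\sum_n\mathbf 1_{K_n}b(\bar f_n)\in L^0(\mathfrak m\llcorner E)$; this does not depend on the choices. (If $\mathfrak m(E)=0$ then $L^0(\mathfrak m\llcorner E)=\{0\}$ and $b\llcorner E=0$.) *)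

theory Defs
  imports "HOL-Analysis.Analysis"
begin

text \<open>
  Spaces are carried by sets: the underlying set of \<open>(X, \<tau>, d, m)\<close> is \<open>X = topspace \<tau>\<close>, and
  \<open>d\<close> is only ever inspected on \<open>X\<close>. The restriction of the space to \<open>E\<close> is therefore
  \<open>(subtopology \<tau> E, d, restrict_space m E)\<close>.
\<close>

definition ext_distance_on :: "'a set \<Rightarrow> ('a \<Rightarrow> 'a \<Rightarrow> ennreal) \<Rightarrow> bool" where
  "ext_distance_on X d \<longleftrightarrow>
     (\<forall>x\<in>X. \<forall>y\<in>X. d x y = d y x) \<and>
     (\<forall>x\<in>X. \<forall>y\<in>X. \<forall>z\<in>X. d x z \<le> d x y + d y z) \<and>
     (\<forall>x\<in>X. \<forall>y\<in>X. d x y = 0 \<longleftrightarrow> x = y)"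

text \<open>In \<^typ>\<open>ennreal\<close>, division by infinity yields 0 and the supremum of the empty set is 0.\<close>

definition Lip :: "('a \<Rightarrow> real) \<Rightarrow> 'a set \<Rightarrow> ('a \<Rightarrow> 'a \<Rightarrow> ennreal) \<Rightarrow> ennreal" where
  "Lip f A d = (SUP (x, y) \<in> {(x, y). x \<in> A \<and> y \<in> A \<and> x \<noteq> y}. ennreal \<bar>f x - f y\<bar> / d x y)"

text \<open>
  Functions on \<open>X\<close> are represented by extensional functions, as in \<^term>\<open>product_topology\<close>;
  pointwise operations on them are accordingly restricted to \<open>X\<close>.
\<close>

definition Lip_b :: "'a topology \<Rightarrow> ('a \<Rightarrow> 'a \<Rightarrow> ennreal) \<Rightarrow> ('a \<Rightarrow> real) set" where
  "Lip_b \<tau> d = {f \<in> extensional (topspace \<tau>).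
     continuous_map \<tau> euclideanreal f \<and> bounded (f ` topspace \<tau>) \<and> Lip f (topspace \<tau>) d < \<infinity>}"

definition Lip_b_norm :: "'a topology \<Rightarrow> ('a \<Rightarrow> 'a \<Rightarrow> ennreal) \<Rightarrow> ('a \<Rightarrow> real) \<Rightarrow> ennreal" where
  "Lip_b_norm \<tau> d f = Lip f (topspace \<tau>) d + (SUP x\<in>topspace \<tau>. ennreal \<bar>f x\<bar>)"

definition Lip_b_ball :: "'a topology \<Rightarrow> ('a \<Rightarrow> 'a \<Rightarrow> ennreal) \<Rightarrow> ('a \<Rightarrow> real) set" where
  "Lip_b_ball \<tau> d = {f \<in> Lip_b \<tau> d. Lip_b_norm \<tau> d f \<le> 1}"

definition initial_topology :: "'b set \<Rightarrow> ('b \<Rightarrow> real) set \<Rightarrow> 'b topology" where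
  "initial_topology Y F =
     topology_generated_by (insert Y {Y \<inter> f -` U | f U. f \<in> F \<and> open U})"

lemma topspace_initial_topology [simp]: "topspace (initial_topology Y F) = Y"
  unfolding initial_topology_def topology_generated_by_topspace by auto

definition emt_space :: "'a topology \<Rightarrow> ('a \<Rightarrow> 'a \<Rightarrow> ennreal) \<Rightarrow> bool" where
  "emt_space \<tau> d \<longleftrightarrow>
     Hausdorff_space \<tau> \<and>
     ext_distance_on (topspace \<tau>) d \<and>
     \<tau> = initial_topology (topspace \<tau>) (Lip_b \<tau> d) \<and>
     (\<forall>x\<in>topspace \<tau>. \<forall>y\<in>topspace \<tau>.
        d x y = (SUP f\<in>{f \<in> Lip_b \<tau> d. Lip f (topspace \<tau>) d \<le> 1}. ennreal \<bar>f x - f y\<bar>))"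

definition radon_measure_on :: "'a topology \<Rightarrow> 'a measure \<Rightarrow> bool" where
  "radon_measure_on \<tau> m \<longleftrightarrow>
     space m = topspace \<tau> \<and>
     sets m = sigma_sets (topspace \<tau>) {U. openin \<tau> U} \<and>
     finite_measure m \<and>
     (\<forall>A\<in>sets m. emeasure m A = (SUP K\<in>{K. compactin \<tau> K \<and> K \<subseteq> A}. emeasure m K))"

definition emtm_space :: "'a topology \<Rightarrow> ('a \<Rightarrow> 'a \<Rightarrow> ennreal) \<Rightarrow> 'a measure \<Rightarrow> bool" where
  "emtm_space \<tau> d m \<longleftrightarrow> emt_space \<tau> d \<and> radon_measure_on \<tau> m"

definition d_separable :: "('a \<Rightarrow> 'a \<Rightarrow> ennreal) \<Rightarrow> 'a set \<Rightarrow> bool" where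
  "d_separable d E \<longleftrightarrow> (\<exists>C. countable C \<and> C \<subseteq> E \<and> (\<forall>x\<in>E. \<forall>\<epsilon>>0. \<exists>c\<in>C. d x c < \<epsilon>))"

definition maximal_separable_component ::
  "('a \<Rightarrow> 'a \<Rightarrow> ennreal) \<Rightarrow> 'a measure \<Rightarrow> 'a set \<Rightarrow> bool" where
  "maximal_separable_component d m S \<longleftrightarrow>
     S \<in> sets m \<and> d_separable d S \<and>
     (\<forall>E\<in>sets m. d_separable d E \<and> E \<subseteq> space m - S \<longrightarrow> emeasure m E = 0)"

text \<open>
  An element of \<open>L\<^sup>0(m)\<close> is given by a measurable representative, equality being almost
  everywhere; a map into \<open>L\<^sup>0(m)\<close> is a choice of representatives.
\<close>

definition lipschitz_derivation ::
  "'a topology \<Rightarrow> ('a \<Rightarrow> 'a \<Rightarrow> ennreal) \<Rightarrow> 'a measure \<Rightarrow> (('a \<Rightarrow> real) \<Rightarrow> ('a \<Rightarrow> real)) \<Rightarrow> bool" where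
  "lipschitz_derivation \<tau> d m b \<longleftrightarrow>
     (\<forall>f\<in>Lip_b \<tau> d. b f \<in> borel_measurable m) \<and>
     (\<forall>f\<in>Lip_b \<tau> d. \<forall>g\<in>Lip_b \<tau> d. \<forall>\<alpha> \<beta>. AE x in m.
        b (\<lambda>y\<in>topspace \<tau>. \<alpha> * f y + \<beta> * g y) x = \<alpha> * b f x + \<beta> * b g x) \<and>
     (\<forall>f\<in>Lip_b \<tau> d. \<forall>g\<in>Lip_b \<tau> d. AE x in m.
        b (\<lambda>y\<in>topspace \<tau>. f y * g y) x = f x * b g x + g x * b f x)"

definition local_derivation ::
  "'a topology \<Rightarrow> ('a \<Rightarrow> 'a \<Rightarrow> ennreal) \<Rightarrow> 'a measure \<Rightarrow> (('a \<Rightarrow> real) \<Rightarrow> ('a \<Rightarrow> real)) \<Rightarrow> bool" where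
  "local_derivation \<tau> d m b \<longleftrightarrow>
     lipschitz_derivation \<tau> d m b \<and>
     (\<forall>f\<in>Lip_b \<tau> d. AE x in m. f x = 0 \<longrightarrow> b f x = 0)"

definition L_infinity :: "'a measure \<Rightarrow> ('a \<Rightarrow> real) set" where
  "L_infinity m = {h \<in> borel_measurable m. \<exists>C. AE x in m. \<bar>h x\<bar> \<le> C}"

text \<open>
  The weak-star topology with respect to the predual \<open>L\<^sup>1(m)\<close>, pulled back from classes to
  representatives. Continuity and convergence into it are the same as for the quotient.
\<close>

definition weak_star_topology :: "'a measure \<Rightarrow> ('a \<Rightarrow> real) topology" where
  "weak_star_topology m =
     initial_topology (L_infinity m)
       {\<lambda>h. integral\<^sup>L m (\<lambda>x. h x * g x) | g. integrable m g}"

definition ball_pointwise_topology ::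
  "'a topology \<Rightarrow> ('a \<Rightarrow> 'a \<Rightarrow> ennreal) \<Rightarrow> ('a \<Rightarrow> real) topology" where
  "ball_pointwise_topology \<tau> d = subtopology (powertop_real (topspace \<tau>)) (Lip_b_ball \<tau> d)"

lemma topspace_ball_pointwise_topology [simp]:
  "topspace (ball_pointwise_topology \<tau> d) = Lip_b_ball \<tau> d"
  by (auto simp: ball_pointwise_topology_def Lip_b_ball_def Lip_b_def PiE_def)

definition weak_star_continuous ::
  "'a topology \<Rightarrow> ('a \<Rightarrow> 'a \<Rightarrow> ennreal) \<Rightarrow> 'a measure \<Rightarrow> (('a \<Rightarrow> real) \<Rightarrow> ('a \<Rightarrow> real)) \<Rightarrow> bool" where
  "weak_star_continuous \<tau> d m b \<longleftrightarrow>
     (\<forall>f\<in>Lip_b \<tau> d. b f \<in> L_infinity m) \<and>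
     continuous_map (ball_pointwise_topology \<tau> d) (weak_star_topology m) b"

definition weak_star_seq_continuous ::
  "'a topology \<Rightarrow> ('a \<Rightarrow> 'a \<Rightarrow> ennreal) \<Rightarrow> 'a measure \<Rightarrow> (('a \<Rightarrow> real) \<Rightarrow> ('a \<Rightarrow> real)) \<Rightarrow> bool" where
  "weak_star_seq_continuous \<tau> d m b \<longleftrightarrow>
     (\<forall>f\<in>Lip_b \<tau> d. b f \<in> L_infinity m) \<and>
     (\<forall>\<sigma> f. range \<sigma> \<subseteq> Lip_b_ball \<tau> d \<and> limitin (ball_pointwise_topology \<tau> d) \<sigma> f sequentially
        \<longrightarrow> limitin (weak_star_topology m) (b \<circ> \<sigma>) (b f) sequentially)"

definition compact_exhaustion :: "'a topology \<Rightarrow> 'a measure \<Rightarrow> 'a set \<Rightarrow> (nat \<Rightarrow> 'a set) \<Rightarrow> bool" where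
  "compact_exhaustion \<tau> m E K \<longleftrightarrow>
     (\<forall>n. compactin \<tau> (K n) \<and> K n \<subseteq> E) \<and> disjoint_family K \<and> emeasure m (E - (\<Union>n. K n)) = 0"

definition Lip_b_extensions ::
  "'a topology \<Rightarrow> ('a \<Rightarrow> 'a \<Rightarrow> ennreal) \<Rightarrow> (nat \<Rightarrow> 'a set) \<Rightarrow> ('a \<Rightarrow> real) \<Rightarrow> (nat \<Rightarrow> 'a \<Rightarrow> real) \<Rightarrow> bool" where
  "Lip_b_extensions \<tau> d K f F \<longleftrightarrow> (\<forall>n. F n \<in> Lip_b \<tau> d \<and> (\<forall>x\<in>K n. F n x = f x))"

text \<open>
  For a local derivation on an extended metric-topological measure space, the choices exist and
  the resulting class in \<open>L\<^sup>0\<close> does not depend on them. At each point at most one term of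
  the series is nonzero.
\<close>

definition restrict_derivation ::
  "'a topology \<Rightarrow> ('a \<Rightarrow> 'a \<Rightarrow> ennreal) \<Rightarrow> 'a measure \<Rightarrow> (('a \<Rightarrow> real) \<Rightarrow> ('a \<Rightarrow> real)) \<Rightarrow> 'a set
     \<Rightarrow> (('a \<Rightarrow> real) \<Rightarrow> ('a \<Rightarrow> real))" where
  "restrict_derivation \<tau> d m b E f =
     (let K = (SOME K. compact_exhaustion \<tau> m E K);
          F = (SOME F. Lip_b_extensions \<tau> d K f F)
      in (\<lambda>x. \<Sum>n. indicator (K n) x * b (F n) x))"

end

theory Submission
  imports Defs
begin

text \<open>
  A bounded continuous \<open>d\<close>-Lipschitz function on a compact set extends to the whole space with the
  same Lipschitz constant and bounds: by the formula for \<open>d\<close> two values can be interpolated, maxima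
  and minima over finite covers approximate the function uniformly, and truncation turns this into a
  uniformly convergent sequence.

  (i) A weak-star continuous functional only sees finitely many points up to a given error, so a
  fixed test function determines a countable set \<open>C\<close>. The \<open>d\<close>-closure of \<open>C\<close> is separable, hence
  null off \<open>S\<close>. Away from it, cutoffs vanishing on finite subsets of \<open>C\<close> and the Leibniz rule force
  the derivation to vanish.

  (ii) On a \<open>d\<close>-separable set, pointwise convergence of 1-Lipschitz functions is convergence on a
  countable dense set, so sequential continuity upgrades to continuity. Sequential continuity passes
  from \<open>b\<close> to its restriction because \<open>b\<close> is local and bounded (Baire), and because a pointwise null
  sequence is uniformly small on large compact sets, from which it extends with small bounds.
\<close>

subsection \<open>Lipschitz functions\<close>

text \<open>Both parts hinge on constants that must not depend on the index of a sequence. In (i),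
  weak-star continuity at 0 controls only functions vanishing on a finite set, and a given
  \<open>f\<close> does not vanish there. Multiplying by a cutoff repairs this, but the cutoff has
  to vanish on a new finite set for each error level while its norm stays bounded. Its Lipschitz
  constant is the reciprocal of a distance, so the argument uses compact sets at one fixed distance
  from all of \<open>C\<close>; what such sets cannot reach is left to separability. In (ii),
  functions on \<open>S\<close> are extended only from compact subsets. A limit along a sequence
  therefore leaves an error on the rest of \<open>S\<close>, which has to be small uniformly along
  the sequence. That each \<open>b f\<close> lies in \<open>L_infinity\<close> gives no common
  bound, and this gap is what Baire fills. Since extension does not enlarge the Lipschitz constant,
  all functions involved stay in a fixed multiple of the unit ball.\<close>

definition lip_on :: "('a \<Rightarrow> 'a \<Rightarrow> ennreal) \<Rightarrow> real \<Rightarrow> 'a set \<Rightarrow> ('a \<Rightarrow> real) \<Rightarrow> bool" where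
  "lip_on d L A f \<longleftrightarrow>
     (\<forall>x\<in>A. \<forall>y\<in>A. d x y < \<infinity> \<longrightarrow> \<bar>f x - f y\<bar> \<le> L * enn2real (d x y))"

lemma lip_onD:
  "lip_on d L A f \<Longrightarrow> x \<in> A \<Longrightarrow> y \<in> A \<Longrightarrow> d x y < \<infinity> \<Longrightarrow> \<bar>f x - f y\<bar> \<le> L * enn2real (d x y)"
  by (simp add: lip_on_def)

lemma lip_on_const: "0 \<le> L \<Longrightarrow> lip_on d L A (\<lambda>_. c)"
  by (simp add: lip_on_def)

lemma lip_on_weaken: "lip_on d L A f \<Longrightarrow> L \<le> L' \<Longrightarrow> lip_on d L' A f"
  unfolding lip_on_def by (meson enn2real_nonneg mult_right_mono order_trans)

lemma lip_on_subset: "lip_on d L A f \<Longrightarrow> B \<subseteq> A \<Longrightarrow> lip_on d L B f"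
  unfolding lip_on_def by blast

lemma lip_on_cong: "(\<And>x. x \<in> A \<Longrightarrow> f x = g x) \<Longrightarrow> lip_on d L A f \<longleftrightarrow> lip_on d L A g"
  unfolding lip_on_def by simp

lemma lip_on_add:
  "lip_on d L A f \<Longrightarrow> lip_on d L' A g \<Longrightarrow> lip_on d (L + L') A (\<lambda>x. f x + g x)"
  unfolding lip_on_def by (smt (verit) distrib_right)

lemma lip_on_cmult:
  assumes "lip_on d L A f" shows "lip_on d (\<bar>c\<bar> * L) A (\<lambda>x. c * f x)"
  unfolding lip_on_def
proof (intro ballI impI)
  fix x y assume "x \<in> A" "y \<in> A" "d x y < \<infinity>"
  then have "\<bar>c\<bar> * \<bar>f x - f y\<bar> \<le> \<bar>c\<bar> * (L * enn2real (d x y))"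
    using assms by (intro mult_left_mono) (auto simp: lip_on_def)
  then show "\<bar>c * f x - c * f y\<bar> \<le> \<bar>c\<bar> * L * enn2real (d x y)"
    by (simp add: right_diff_distrib[symmetric] abs_mult mult.assoc)
qed

lemma lip_on_uminus: "lip_on d L A f \<Longrightarrow> lip_on d L A (\<lambda>x. - f x)"
  unfolding lip_on_def by (auto simp: abs_minus_commute)

lemma lip_on_diff:
  "lip_on d L A f \<Longrightarrow> lip_on d L' A g \<Longrightarrow> lip_on d (L + L') A (\<lambda>x. f x - g x)"
  using lip_on_add[OF _ lip_on_uminus] by fastforce

lemma lip_on_max:
  "lip_on d L A f \<Longrightarrow> lip_on d L A g \<Longrightarrow> lip_on d L A (\<lambda>x. max (f x) (g x))"
  unfolding lip_on_def by (smt (verit))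

lemma lip_on_min:
  "lip_on d L A f \<Longrightarrow> lip_on d L A g \<Longrightarrow> lip_on d L A (\<lambda>x. min (f x) (g x))"
  unfolding lip_on_def by (smt (verit))

lemma lip_on_mult:
  assumes f: "lip_on d L A f" "\<And>x. x \<in> A \<Longrightarrow> \<bar>f x\<bar> \<le> M"
    and g: "lip_on d L' A g" "\<And>x. x \<in> A \<Longrightarrow> \<bar>g x\<bar> \<le> M'"
  shows "lip_on d (M * L' + M' * L) A (\<lambda>x. f x * g x)"
  unfolding lip_on_def
proof (intro ballI impI)
  fix x y assume xy: "x \<in> A" "y \<in> A" "d x y < \<infinity>"
  let ?r = "enn2real (d x y)"
  have "f x * g x - f y * g y = f x * (g x - g y) + g y * (f x - f y)"
    by (simp add: algebra_simps)
  then have "\<bar>f x * g x - f y * g y\<bar> \<le> \<bar>f x\<bar> * \<bar>g x - g y\<bar> + \<bar>g y\<bar> * \<bar>f x - f y\<bar>"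
    using abs_triangle_ineq[of "f x * (g x - g y)" "g y * (f x - f y)"] by (simp add: abs_mult)
  also have "\<dots> \<le> M * (L' * ?r) + M' * (L * ?r)"
    using f(2)[OF xy(1)] g(2)[OF xy(2)] lip_onD[OF f(1) xy] lip_onD[OF g(1) xy]
    by (intro add_mono mult_mono) auto
  finally show "\<bar>f x * g x - f y * g y\<bar> \<le> (M * L' + M' * L) * ?r"
    by (simp add: algebra_simps)
qed

lemma lip_on_limit:
  assumes "\<And>n. lip_on d L A (f n)" "\<And>x. x \<in> A \<Longrightarrow> (\<lambda>n. f n x) \<longlonglongrightarrow> g x"
  shows "lip_on d L A g"
  unfolding lip_on_def
proof (intro ballI impI)
  fix x y assume xy: "x \<in> A" "y \<in> A" "d x y < \<infinity>"
  have "(\<lambda>n. \<bar>f n x - f n y\<bar>) \<longlonglongrightarrow> \<bar>g x - g y\<bar>"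
    using assms(2) xy by (intro tendsto_intros) auto
  then show "\<bar>g x - g y\<bar> \<le> L * enn2real (d x y)"
    using lip_onD[OF assms(1) xy] by (intro LIMSEQ_le_const2) auto
qed

text \<open>Passage from \<open>ennreal\<close> quotients to real arithmetic. At infinite distance
  the quotient is 0 and \<open>lip_on\<close> demands nothing; at finite distance
  \<open>d x y > 0\<close> for distinct points, so the denominator can be cleared. The pairs
  \<open>x = y\<close>, absent from \<open>Lip\<close>, are harmless because
  \<open>0 \<le> L\<close>.\<close>

lemma Lip_le_iff:
  assumes d: "ext_distance_on A d" and L: "0 \<le> L"
  shows "Lip f A d \<le> ennreal L \<longleftrightarrow> lip_on d L A f"
proof -
  have "ennreal \<bar>f x - f y\<bar> / d x y \<le> ennreal L \<longleftrightarrow>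
      (d x y < \<infinity> \<longrightarrow> \<bar>f x - f y\<bar> \<le> L * enn2real (d x y))"
    if "x \<in> A" "y \<in> A" "x \<noteq> y" for x y
  proof (cases "d x y")
    case (real r)
    moreover have "d x y \<noteq> 0"
      using d that by (auto simp: ext_distance_on_def)
    ultimately have "r > 0" by auto
    with real L show ?thesis
      by (simp add: divide_ennreal pos_divide_le_eq)
  next
    case top
    then show ?thesis by simp
  qed
  then have "Lip f A d \<le> ennreal L \<longleftrightarrow> (\<forall>x\<in>A. \<forall>y\<in>A. x \<noteq> y \<longrightarrow>
      d x y < \<infinity> \<longrightarrow> \<bar>f x - f y\<bar> \<le> L * enn2real (d x y))"
    unfolding Lip_def SUP_le_iff by auto
  also have "\<dots> \<longleftrightarrow> lip_on d L A f"
    unfolding lip_on_def using L by (metis abs_0 diff_self enn2real_nonneg mult_nonneg_nonneg)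
  finally show ?thesis .
qed

lemma Lip_b_iff:
  assumes d: "ext_distance_on (topspace \<tau>) d"
  shows "f \<in> Lip_b \<tau> d \<longleftrightarrow> f \<in> extensional (topspace \<tau>) \<and> continuous_map \<tau> euclideanreal f \<and>
    (\<exists>M. \<forall>x\<in>topspace \<tau>. \<bar>f x\<bar> \<le> M) \<and> (\<exists>L\<ge>0. lip_on d L (topspace \<tau>) f)"
proof -
  have "Lip f (topspace \<tau>) d < \<infinity> \<longleftrightarrow> (\<exists>L\<ge>0. Lip f (topspace \<tau>) d \<le> ennreal L)"
    by (metis enn2real_nonneg ennreal_enn2real ennreal_less_top infinity_ennreal_def
        order_le_less_trans order_refl)
  also have "\<dots> \<longleftrightarrow> (\<exists>L\<ge>0. lip_on d L (topspace \<tau>) f)"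
    using Lip_le_iff[OF d] by blast
  finally show ?thesis
    unfolding Lip_b_def by (auto simp: bounded_iff)
qed

lemma Lip_bE:
  assumes "ext_distance_on (topspace \<tau>) d" "f \<in> Lip_b \<tau> d"
  obtains L M where "0 < L" "0 < M" "lip_on d L (topspace \<tau>) f" "\<And>x. x \<in> topspace \<tau> \<Longrightarrow> \<bar>f x\<bar> \<le> M"
    "f \<in> extensional (topspace \<tau>)" "continuous_map \<tau> euclideanreal f"
proof -
  obtain L M where "0 \<le> L" "lip_on d L (topspace \<tau>) f" "\<And>x. x \<in> topspace \<tau> \<Longrightarrow> \<bar>f x\<bar> \<le> M"
    using assms by (auto simp: Lip_b_iff)
  then show ?thesis
    \<comment> \<open>Adding 1 makes both constants strictly positive: extension divides by the
      Lipschitz constant, and rescalings divide by \<open>L + M\<close>.\<close>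
    using that[of "L + 1" "\<bar>M\<bar> + 1"] lip_on_weaken[of d L "topspace \<tau>" f "L + 1"] assms
    by (force simp: Lip_b_iff)
qed

lemma Lip_bI:
  assumes "ext_distance_on (topspace \<tau>) d" "continuous_map \<tau> euclideanreal f"
    "\<And>x. x \<in> topspace \<tau> \<Longrightarrow> \<bar>f x\<bar> \<le> M" "0 \<le> L" "lip_on d L (topspace \<tau>) f"
  shows "restrict f (topspace \<tau>) \<in> Lip_b \<tau> d"
  using assms lip_on_cong[of "topspace \<tau>" "restrict f (topspace \<tau>)" f d L]
  by (auto simp: Lip_b_iff intro: continuous_map_eq)

text \<open>The norm is a sum, so the Lipschitz bound and the supremum bound share a budget of 1.
  The scaling factors \<open>1 / (L + M)\<close> and \<open>1 / D\<close> used below come from this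
  condition.\<close>

lemma Lip_b_ballI:
  assumes "ext_distance_on (topspace \<tau>) d" "f \<in> Lip_b \<tau> d" "0 \<le> L" "0 \<le> M" "L + M \<le> 1"
    "lip_on d L (topspace \<tau>) f" "\<And>x. x \<in> topspace \<tau> \<Longrightarrow> \<bar>f x\<bar> \<le> M"
  shows "f \<in> Lip_b_ball \<tau> d"
proof -
  have "Lip f (topspace \<tau>) d \<le> ennreal L" "(SUP x\<in>topspace \<tau>. ennreal \<bar>f x\<bar>) \<le> ennreal M"
    using assms by (auto simp: Lip_le_iff SUP_le_iff intro!: ennreal_leI)
  then have "Lip_b_norm \<tau> d f \<le> ennreal L + ennreal M"
    unfolding Lip_b_norm_def by (rule add_mono)
  also have "\<dots> \<le> 1"
    using assms by (simp add: ennreal_plus[symmetric] del: ennreal_plus)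
  finally show ?thesis
    using assms by (simp add: Lip_b_ball_def)
qed

lemma Lip_b_ballD:
  assumes "ext_distance_on (topspace \<tau>) d" "f \<in> Lip_b_ball \<tau> d"
  shows "f \<in> Lip_b \<tau> d" "lip_on d 1 (topspace \<tau>) f" "x \<in> topspace \<tau> \<Longrightarrow> \<bar>f x\<bar> \<le> 1"
proof -
  have *: "Lip f (topspace \<tau>) d + (SUP x\<in>topspace \<tau>. ennreal \<bar>f x\<bar>) \<le> 1"
    using assms by (auto simp: Lip_b_ball_def Lip_b_norm_def)
  show "f \<in> Lip_b \<tau> d"
    using assms by (simp add: Lip_b_ball_def)
  have "Lip f (topspace \<tau>) d \<le> ennreal 1"
    using * by (metis ennreal_1 le_iff_add order_trans)
  then show "lip_on d 1 (topspace \<tau>) f"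
    using Lip_le_iff[OF assms(1), of 1] by simp
  have "(SUP x\<in>topspace \<tau>. ennreal \<bar>f x\<bar>) \<le> 1"
    using * by (metis add.commute le_iff_add order_trans)
  then show "\<bar>f x\<bar> \<le> 1" if "x \<in> topspace \<tau>"
    using that by (metis SUP_le_iff ennreal_le_1)
qed

lemma Lip_b_lincomb:
  assumes "ext_distance_on (topspace \<tau>) d" "f \<in> Lip_b \<tau> d" "g \<in> Lip_b \<tau> d"
  shows "(\<lambda>x\<in>topspace \<tau>. \<alpha> * f x + \<beta> * g x) \<in> Lip_b \<tau> d"
proof -
  obtain L M where f: "0 < L" "0 < M" "lip_on d L (topspace \<tau>) f"
    "\<And>x. x \<in> topspace \<tau> \<Longrightarrow> \<bar>f x\<bar> \<le> M" "continuous_map \<tau> euclideanreal f"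
    using Lip_bE[OF assms(1,2)] by metis
  obtain L' M' where g: "0 < L'" "0 < M'" "lip_on d L' (topspace \<tau>) g"
    "\<And>x. x \<in> topspace \<tau> \<Longrightarrow> \<bar>g x\<bar> \<le> M'" "continuous_map \<tau> euclideanreal g"
    using Lip_bE[OF assms(1,3)] by metis
  show ?thesis
  proof (rule Lip_bI[OF assms(1)])
    show "continuous_map \<tau> euclideanreal (\<lambda>x. \<alpha> * f x + \<beta> * g x)"
      by (intro continuous_intros f g)
    show "\<bar>\<alpha> * f x + \<beta> * g x\<bar> \<le> \<bar>\<alpha>\<bar> * M + \<bar>\<beta>\<bar> * M'" if "x \<in> topspace \<tau>" for x
    proof -
      have "\<bar>\<alpha> * f x\<bar> \<le> \<bar>\<alpha>\<bar> * M" "\<bar>\<beta> * g x\<bar> \<le> \<bar>\<beta>\<bar> * M'"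
        using f(4)[OF that] g(4)[OF that] by (auto simp: abs_mult intro: mult_left_mono)
      then show ?thesis by linarith
    qed
    show "lip_on d (\<bar>\<alpha>\<bar> * L + \<bar>\<beta>\<bar> * L') (topspace \<tau>) (\<lambda>x. \<alpha> * f x + \<beta> * g x)"
      by (intro lip_on_add lip_on_cmult f g)
  qed (use f g in simp)
qed

lemma Lip_b_mult:
  assumes "ext_distance_on (topspace \<tau>) d" "f \<in> Lip_b \<tau> d" "g \<in> Lip_b \<tau> d"
  shows "(\<lambda>x\<in>topspace \<tau>. f x * g x) \<in> Lip_b \<tau> d"
proof -
  obtain L M where f: "0 < L" "0 < M" "lip_on d L (topspace \<tau>) f"
    "\<And>x. x \<in> topspace \<tau> \<Longrightarrow> \<bar>f x\<bar> \<le> M" "continuous_map \<tau> euclideanreal f"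
    using Lip_bE[OF assms(1,2)] by metis
  obtain L' M' where g: "0 < L'" "0 < M'" "lip_on d L' (topspace \<tau>) g"
    "\<And>x. x \<in> topspace \<tau> \<Longrightarrow> \<bar>g x\<bar> \<le> M'" "continuous_map \<tau> euclideanreal g"
    using Lip_bE[OF assms(1,3)] by metis
  show ?thesis
  proof (rule Lip_bI[OF assms(1)])
    show "continuous_map \<tau> euclideanreal (\<lambda>x. f x * g x)"
      by (intro continuous_intros f g)
    show "\<bar>f x * g x\<bar> \<le> M * M'" if "x \<in> topspace \<tau>" for x
      using f(4)[OF that] g(4)[OF that] by (simp add: abs_mult mult_mono')
    show "lip_on d (M * L' + M' * L) (topspace \<tau>) (\<lambda>x. f x * g x)"
      by (intro lip_on_mult f g)
  qed (use f g in simp)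
qed

subsection \<open>Extension from compact sets\<close>

text \<open>The open sets where \<open>f < \<phi>\<close> cover \<open>K\<close>; a finite subcover
  suffices, and the maximum of the finitely many functions stays in the family. Applied to negated
  functions, the same statement also produces minima.\<close>

lemma compactin_ex_greater:
  fixes f :: "'a \<Rightarrow> real"
  assumes K: "compactin \<tau> K" and ne: "\<F> \<noteq> {}"
    and max: "\<And>\<phi> \<psi>. \<phi> \<in> \<F> \<Longrightarrow> \<psi> \<in> \<F> \<Longrightarrow> (\<lambda>x. max (\<phi> x) (\<psi> x)) \<in> \<F>"
    and cont: "\<And>\<phi>. \<phi> \<in> \<F> \<Longrightarrow> continuous_map (subtopology \<tau> K) euclideanreal \<phi>"
    and f: "continuous_map (subtopology \<tau> K) euclideanreal f"
    and ex: "\<And>y. y \<in> K \<Longrightarrow> \<exists>\<phi>\<in>\<F>. f y < \<phi> y"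
  shows "\<exists>\<phi>\<in>\<F>. \<forall>y\<in>K. f y < \<phi> y"
proof -
  have top: "topspace (subtopology \<tau> K) = K"
    using compactin_subset_topspace[OF K] by auto
  define U where "U \<phi> = {y \<in> K. f y < \<phi> y}" for \<phi>
  have "openin (subtopology \<tau> K) (U \<phi>)" if "\<phi> \<in> \<F>" for \<phi>
    using openin_continuous_map_preimage[OF continuous_map_diff[OF cont[OF that] f], of "{0<..}"]
    unfolding U_def top by simp
  moreover have "K \<subseteq> \<Union>(U ` \<F>)"
    using ex by (auto simp: U_def)
  ultimately obtain \<G> where "finite \<G>" "\<G> \<subseteq> U ` \<F>" "K \<subseteq> \<Union>\<G>"
    using compactinD[of "subtopology \<tau> K" K "U ` \<F>"] K by auto
  then obtain G where G: "finite G" "G \<subseteq> \<F>" "K \<subseteq> \<Union>(U ` G)"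
    by (metis finite_subset_image)
  have "\<exists>\<phi>\<in>\<F>. \<forall>\<psi>\<in>G. \<forall>y. \<psi> y \<le> \<phi> y"
    using G(1,2)
  proof (induction G)
    case empty
    then show ?case using ne by auto
  next
    case (insert \<psi> G)
    then obtain \<phi> where "\<phi> \<in> \<F>" "\<forall>\<psi>\<in>G. \<forall>y. \<psi> y \<le> \<phi> y" by auto
    then show ?case
      using insert.prems max[of \<psi> \<phi>] by (intro bexI[of _ "\<lambda>x. max (\<psi> x) (\<phi> x)"]) (auto simp: le_max_iff_disj)
  qed
  then obtain \<phi> where \<phi>: "\<phi> \<in> \<F>" "\<And>\<psi> y. \<psi> \<in> G \<Longrightarrow> \<psi> y \<le> \<phi> y" by auto
  have "f y < \<phi> y" if y: "y \<in> K" for y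
  proof -
    obtain \<psi> where "\<psi> \<in> G" "y \<in> U \<psi>" using G(3) y by blast
    then show ?thesis using \<phi>(2)[of \<psi> y] by (simp add: U_def)
  qed
  then show ?thesis using \<phi>(1) by blast
qed

text \<open>Unlike \<open>Lip_b\<close>, this asks for neither boundedness nor extensionality, so
  lattice operations and affine maps stay inside without \<open>restrict\<close>. Truncation and
  restriction are postponed to the end of the extension argument.\<close>

definition cont_lip :: "'a topology \<Rightarrow> ('a \<Rightarrow> 'a \<Rightarrow> ennreal) \<Rightarrow> real \<Rightarrow> ('a \<Rightarrow> real) set" where
  "cont_lip \<tau> d L = {\<phi>. continuous_map \<tau> euclideanreal \<phi> \<and> lip_on d L (topspace \<tau>) \<phi>}"

lemma cont_lip_const: "0 \<le> L \<Longrightarrow> (\<lambda>_. c) \<in> cont_lip \<tau> d L"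
  by (simp add: cont_lip_def lip_on_const)

lemma cont_lip_max:
  "\<phi> \<in> cont_lip \<tau> d L \<Longrightarrow> \<psi> \<in> cont_lip \<tau> d L \<Longrightarrow> (\<lambda>x. max (\<phi> x) (\<psi> x)) \<in> cont_lip \<tau> d L"
  by (simp add: cont_lip_def lip_on_max continuous_map_real_max)

lemma cont_lip_min:
  "\<phi> \<in> cont_lip \<tau> d L \<Longrightarrow> \<psi> \<in> cont_lip \<tau> d L \<Longrightarrow> (\<lambda>x. min (\<phi> x) (\<psi> x)) \<in> cont_lip \<tau> d L"
  by (simp add: cont_lip_def lip_on_min continuous_map_real_min)

lemma cont_lip_uminus: "\<phi> \<in> cont_lip \<tau> d L \<Longrightarrow> (\<lambda>x. - \<phi> x) \<in> cont_lip \<tau> d L"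
  by (simp add: cont_lip_def lip_on_uminus)

lemma cont_lip_affine:
  assumes "\<phi> \<in> cont_lip \<tau> d L" "\<bar>c\<bar> * L \<le> L'" "0 \<le> L"
  shows "(\<lambda>x. a + c * \<phi> x) \<in> cont_lip \<tau> d L'"
proof -
  have "lip_on d (0 + \<bar>c\<bar> * L) (topspace \<tau>) (\<lambda>x. a + c * \<phi> x)"
    using assms by (intro lip_on_add lip_on_const lip_on_cmult) (auto simp: cont_lip_def)
  then have "lip_on d L' (topspace \<tau>) (\<lambda>x. a + c * \<phi> x)"
    using assms by (auto elim: lip_on_weaken)
  moreover have "continuous_map \<tau> euclideanreal (\<lambda>x. a + c * \<phi> x)"
    using assms by (intro continuous_map_add continuous_map_real_mult) (auto simp: cont_lip_def)
  ultimately show ?thesis by (simp add: cont_lip_def)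
qed

locale emt =
  fixes \<tau> :: "'a topology" and d :: "'a \<Rightarrow> 'a \<Rightarrow> ennreal"
  assumes emt: "emt_space \<tau> d"
begin

lemma Hausdorff: "Hausdorff_space \<tau>" and ext_distance: "ext_distance_on (topspace \<tau>) d"
  using emt unfolding emt_space_def by blast+

lemma distance_eq_SUP:
  "x \<in> topspace \<tau> \<Longrightarrow> y \<in> topspace \<tau> \<Longrightarrow>
    d x y = (SUP f\<in>{f \<in> Lip_b \<tau> d. Lip f (topspace \<tau>) d \<le> 1}. ennreal \<bar>f x - f y\<bar>)"
  using emt unfolding emt_space_def by blast

text \<open>The formula for \<open>d\<close> in witness form: one 1-Lipschitz function certifies a
  strict lower bound, also when the distance is infinite. Interpolation and the semicontinuity of
  \<open>d\<close> both start from here.\<close>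

lemma less_distance_iff:
  assumes "x \<in> topspace \<tau>" "y \<in> topspace \<tau>"
  shows "r < d x y \<longleftrightarrow> (\<exists>\<phi>\<in>Lip_b \<tau> d. \<phi> \<in> cont_lip \<tau> d 1 \<and> r < ennreal \<bar>\<phi> x - \<phi> y\<bar>)"
proof -
  have "r < d x y \<longleftrightarrow> (\<exists>\<phi>\<in>{f \<in> Lip_b \<tau> d. Lip f (topspace \<tau>) d \<le> 1}. r < ennreal \<bar>\<phi> x - \<phi> y\<bar>)"
    by (simp add: distance_eq_SUP[OF assms] less_SUP_iff)
  then show ?thesis
    using Lip_le_iff[OF ext_distance, of 1] by (auto simp: cont_lip_def Lip_b_def)
qed

text \<open>A 1-Lipschitz function nearly realizing \<open>d x y\<close> is composed with an affine
  map of slope at most \<open>L\<close>. The value at \<open>x\<close> is exact; the loss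
  \<open>\<epsilon>\<close> at \<open>y\<close> reflects that the supremum defining \<open>d\<close>
  need not be attained.\<close>

lemma ex_interpolating_pair:
  assumes "0 < L" "0 < \<epsilon>" and xy: "x \<in> topspace \<tau>" "y \<in> topspace \<tau>"
    and st: "d x y < \<infinity> \<Longrightarrow> \<bar>s - t\<bar> \<le> L * enn2real (d x y)"
  shows "\<exists>\<phi>\<in>cont_lip \<tau> d L. \<phi> x = s \<and> \<bar>\<phi> y - t\<bar> < \<epsilon>"
proof (cases "\<bar>t - s\<bar> < \<epsilon>")
  case True
  then show ?thesis
    using assms(1) by (intro bexI[OF _ cont_lip_const[of L s]]) auto
next
  case False
  define a where "a = t - s"
  \<comment> \<open>Since \<open>|a| \<ge> \<epsilon>\<close> in this case, the threshold is
    nonnegative and \<open>ennreal\<close> does not truncate it. It lies strictly below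
    \<open>d x y\<close> because \<open>|a|\<close> is at most \<open>L\<close> times the distance
    when that is finite.\<close>
  have "ennreal ((\<bar>a\<bar> - \<epsilon>) / L) < d x y"
  proof (cases "d x y")
    case (real r)
    then have "\<bar>a\<bar> \<le> L * r" using st by (auto simp: a_def abs_minus_commute)
    then have "(\<bar>a\<bar> - \<epsilon>) / L < r"
      using assms(1,2) by (simp add: pos_divide_less_eq mult.commute)
    then show ?thesis
      using real False assms(1) by (simp add: a_def ennreal_less_iff)
  qed simp
  then obtain \<phi> where \<phi>: "\<phi> \<in> cont_lip \<tau> d 1" "ennreal ((\<bar>a\<bar> - \<epsilon>) / L) < ennreal \<bar>\<phi> x - \<phi> y\<bar>"
    using less_distance_iff[OF xy] by blast
  define u where "u = \<phi> y - \<phi> x"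
  have "(\<bar>a\<bar> - \<epsilon>) / L < \<bar>u\<bar>"
    using \<phi>(2) False assms(1) by (simp add: ennreal_less_iff u_def a_def abs_minus_commute)
  then have u: "\<bar>a\<bar> - \<epsilon> < L * \<bar>u\<bar>"
    using assms(1) by (simp add: pos_divide_less_eq mult.commute)
  have "u \<noteq> 0" using u False by (auto simp: a_def)
  \<comment> \<open>The exact slope \<open>a / u\<close> is used if it is admissible; otherwise the
    extreme slope of the right sign falls short by less than \<open>\<epsilon>\<close>.\<close>
  have "\<exists>c. \<bar>c\<bar> \<le> L \<and> \<bar>c * u - a\<bar> < \<epsilon>"
  proof (cases "\<bar>a\<bar> \<le> L * \<bar>u\<bar>")
    case True
    then show ?thesis
      using \<open>u \<noteq> 0\<close> assms(2) by (intro exI[of _ "a / u"]) (simp add: pos_divide_le_eq)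
  next
    case c: False
    have "\<bar>L * sgn a * sgn u * u - a\<bar> = \<bar>sgn a * (L * \<bar>u\<bar> - \<bar>a\<bar>)\<bar>"
      by (simp add: sgn_if abs_if algebra_simps)
    also have "\<dots> < \<epsilon>"
      using c u assms(2) by (auto simp: abs_mult sgn_if)
    finally show ?thesis
      using assms(1) by (intro exI[of _ "L * sgn a * sgn u"]) (auto simp: abs_mult sgn_if)
  qed
  then obtain c where c: "\<bar>c\<bar> \<le> L" "\<bar>c * u - a\<bar> < \<epsilon>" by blast
  show ?thesis
  proof (intro bexI conjI)
    show "(\<lambda>z. (s - c * \<phi> x) + c * \<phi> z) \<in> cont_lip \<tau> d L"
      using c \<phi>(1) by (intro cont_lip_affine[where L = 1]) auto
    show "\<bar>s - c * \<phi> x + c * \<phi> y - t\<bar> < \<epsilon>"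
      using c(2) by (simp add: u_def a_def algebra_simps)
  qed simp
qed

text \<open>The lattice form of Stone-Weierstrass. Interpolation at pairs \<open>x\<close>,
  \<open>y\<close> becomes a lower bound on all of \<open>K\<close> by compactness in
  \<open>y\<close>, then a two-sided bound by compactness in \<open>x\<close>. Maxima and sign
  changes keep the constant \<open>L\<close>.\<close>

lemma approximate_extension:
  assumes K: "compactin \<tau> K" and L: "0 < L" and \<epsilon>: "0 < \<epsilon>"
    and f: "continuous_map (subtopology \<tau> K) euclideanreal f" "lip_on d L K f"
  shows "\<exists>\<phi>\<in>cont_lip \<tau> d L. \<forall>y\<in>K. \<bar>\<phi> y - f y\<bar> < \<epsilon>"
proof -
  have KX: "K \<subseteq> topspace \<tau>" using compactin_subset_topspace[OF K] .
  have cont: "continuous_map (subtopology \<tau> K) euclideanreal \<phi>" if "\<phi> \<in> cont_lip \<tau> d L" for \<phi>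
    using that by (simp add: cont_lip_def continuous_map_from_subtopology)
  have pair: "\<exists>\<phi>\<in>cont_lip \<tau> d L. \<phi> x = f x \<and> \<bar>\<phi> y - f y\<bar> < \<epsilon>" if "x \<in> K" "y \<in> K" for x y
    using that KX lip_onD[OF f(2) that] by (intro ex_interpolating_pair L \<epsilon>) auto
  have below: "\<exists>\<phi>\<in>cont_lip \<tau> d L. \<phi> x < f x + \<epsilon> \<and> (\<forall>y\<in>K. f y - \<epsilon> < \<phi> y)" if x: "x \<in> K" for x
  proof -
    have "\<exists>\<phi>\<in>{\<phi>\<in>cont_lip \<tau> d L. \<phi> x < f x + \<epsilon>}. \<forall>y\<in>K. f y - \<epsilon> < \<phi> y"
    proof (rule compactin_ex_greater[OF K])
      show "{\<phi> \<in> cont_lip \<tau> d L. \<phi> x < f x + \<epsilon>} \<noteq> {}"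
        using pair[OF x x] \<epsilon> by auto
      show "\<exists>\<phi>\<in>{\<phi> \<in> cont_lip \<tau> d L. \<phi> x < f x + \<epsilon>}. f y - \<epsilon> < \<phi> y" if "y \<in> K" for y
        using pair[OF x that] \<epsilon> by force
      show "continuous_map (subtopology \<tau> K) euclideanreal (\<lambda>y. f y - \<epsilon>)"
        using f(1) by (intro continuous_map_diff) auto
      show "continuous_map (subtopology \<tau> K) euclideanreal \<phi>"
        if "\<phi> \<in> {\<phi> \<in> cont_lip \<tau> d L. \<phi> x < f x + \<epsilon>}" for \<phi>
        using that cont by blast
    qed (simp add: cont_lip_max)
    then show ?thesis by auto
  qed
  \<comment> \<open>The required minimum is a maximum of negated functions. Membership in the family
    records the bound already secured on all of \<open>K\<close>, which survives maxima.\<close>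
  have "\<exists>\<psi>\<in>{\<psi>\<in>cont_lip \<tau> d L. \<forall>y\<in>K. \<psi> y < - f y + \<epsilon>}. \<forall>y\<in>K. - f y - \<epsilon> < \<psi> y"
  proof (cases "K = {}")
    case True
    then show ?thesis using cont_lip_const[of L 0 \<tau> d] L by auto
  next
    case False
    have neg: "\<exists>\<psi>\<in>{\<psi>\<in>cont_lip \<tau> d L. \<forall>y\<in>K. \<psi> y < - f y + \<epsilon>}. - f x - \<epsilon> < \<psi> x" if x: "x \<in> K" for x
    proof -
      obtain \<phi> where "\<phi> \<in> cont_lip \<tau> d L" "\<phi> x < f x + \<epsilon>" "\<forall>y\<in>K. f y - \<epsilon> < \<phi> y"
        using below[OF x] by blast
      then show ?thesis
        by (intro bexI[of _ "\<lambda>z. - \<phi> z"]) (auto intro!: cont_lip_uminus)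
    qed
    show ?thesis
    proof (rule compactin_ex_greater[OF K])
      show "{\<psi> \<in> cont_lip \<tau> d L. \<forall>y\<in>K. \<psi> y < - f y + \<epsilon>} \<noteq> {}"
        using neg False by blast
      show "continuous_map (subtopology \<tau> K) euclideanreal (\<lambda>y. - f y - \<epsilon>)"
        using f(1) by (intro continuous_map_diff continuous_map_minus) auto
      show "continuous_map (subtopology \<tau> K) euclideanreal \<psi>"
        if "\<psi> \<in> {\<psi> \<in> cont_lip \<tau> d L. \<forall>y\<in>K. \<psi> y < - f y + \<epsilon>}" for \<psi>
        using that cont by blast
    qed (simp add: cont_lip_max, fact neg)
  qed
  then obtain \<psi> where \<psi>: "\<psi> \<in> cont_lip \<tau> d L" "\<forall>y\<in>K. \<psi> y < - f y + \<epsilon>" "\<forall>y\<in>K. - f y - \<epsilon> < \<psi> y"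
    by auto
  show ?thesis
    using \<psi>(2,3) by (intro bexI[OF _ cont_lip_uminus[OF \<psi>(1)]]) force
qed

text \<open>The lattice operations preserve the Lipschitz constant, so each approximation can be
  clamped to within the current error of the previous one without leaving \<^const>\<open>cont_lip\<close>.\<close>

lemma exact_extension:
  assumes K: "compactin \<tau> K" and L: "0 < L"
    and f: "continuous_map (subtopology \<tau> K) euclideanreal f" "lip_on d L K f"
  shows "\<exists>\<phi>\<in>cont_lip \<tau> d L. \<forall>y\<in>K. \<phi> y = f y"
proof -
  define e where "e n = (1/2 :: real) ^ n" for n
  have e: "e n > 0" "e (Suc n) = e n / 2" for n
    by (simp_all add: e_def)
  have KX: "K \<subseteq> topspace \<tau>" using compactin_subset_topspace[OF K] .
  have "\<exists>G. \<forall>n. (G n \<in> cont_lip \<tau> d L \<and> (\<forall>y\<in>K. \<bar>G n y - f y\<bar> < e n)) \<and>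
      (\<forall>x. \<bar>G (Suc n) x - G n x\<bar> \<le> 2 * e n)"
  proof (rule dependent_nat_choice)
    show "\<exists>\<phi>. \<phi> \<in> cont_lip \<tau> d L \<and> (\<forall>y\<in>K. \<bar>\<phi> y - f y\<bar> < e 0)"
      using approximate_extension[OF K L e(1) f] by blast
  next
    fix \<phi> n
    assume \<phi>: "\<phi> \<in> cont_lip \<tau> d L \<and> (\<forall>y\<in>K. \<bar>\<phi> y - f y\<bar> < e n)"
    obtain \<psi> where \<psi>: "\<psi> \<in> cont_lip \<tau> d L" "\<And>y. y \<in> K \<Longrightarrow> \<bar>\<psi> y - f y\<bar> < e (Suc n)"
      using approximate_extension[OF K L e(1) f] by blast
    \<comment> \<open>On \<open>K\<close> the clamp is inactive: \<open>\<phi>\<close> and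
      \<open>\<psi>\<close> differ there by less than \<open>e n + e (Suc n)\<close>, which is below
      \<open>2 * e n\<close>. The factor 1 brings the bounds into the shape of
      \<open>cont_lip_affine\<close>.\<close>
    let ?\<psi> = "\<lambda>x. max (-2 * e n + 1 * \<phi> x) (min (2 * e n + 1 * \<phi> x) (\<psi> x))"
    have "?\<psi> \<in> cont_lip \<tau> d L"
      using \<phi> \<psi>(1) L by (intro cont_lip_max cont_lip_min cont_lip_affine[where L = L]) auto
    moreover have "\<bar>?\<psi> y - f y\<bar> < e (Suc n)" if "y \<in> K" for y
      using \<phi> \<psi>(2)[OF that] that e[of n] by (smt (verit) field_sum_of_halves)
    moreover have "\<bar>?\<psi> x - \<phi> x\<bar> \<le> 2 * e n" for x
      using e(1)[of n] by (simp add: abs_if max_def min_def)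
    ultimately show "\<exists>\<psi>. (\<psi> \<in> cont_lip \<tau> d L \<and> (\<forall>y\<in>K. \<bar>\<psi> y - f y\<bar> < e (Suc n))) \<and>
        (\<forall>x. \<bar>\<psi> x - \<phi> x\<bar> \<le> 2 * e n)" by blast
  qed
  then obtain G where G: "\<And>n. G n \<in> cont_lip \<tau> d L" "\<And>n y. y \<in> K \<Longrightarrow> \<bar>G n y - f y\<bar> < e n"
    "\<And>n x. \<bar>G (Suc n) x - G n x\<bar> \<le> 2 * e n" by blast
  \<comment> \<open>Telescoping form: \<open>2 * e n = 4 * e n - 4 * e (Suc n)\<close> because
    \<open>e\<close> halves at each step.\<close>
  have G_add: "\<bar>G (n + k) x - G n x\<bar> \<le> 4 * e n - 4 * e (n + k)" for n k x
  proof (induction k)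
    case (Suc k)
    then show ?case
      using G(3)[of "n + k" x] e(2)[of "n + k"] by simp
  qed simp
  have G_le: "\<bar>G k x - G n x\<bar> \<le> 4 * e n" if "n \<le> k" for n k x
    using G_add[of n "k - n" x] e(1)[of k] that by simp
  have e0: "e \<longlonglongrightarrow> 0"
    unfolding e_def by (rule LIMSEQ_power_zero) simp
  \<comment> \<open>The clamp bounds consecutive differences on the whole space and not only on
    \<open>K\<close>, so the sequence is uniformly Cauchy there and its limit is continuous
    everywhere.\<close>
  obtain \<phi> where \<phi>: "continuous_map \<tau> euclideanreal \<phi>"
    "\<And>\<epsilon>. 0 < \<epsilon> \<Longrightarrow> \<forall>\<^sub>F n in sequentially. \<forall>x\<in>topspace \<tau>. dist (G n x) (\<phi> x) < \<epsilon>"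
  proof (rule Met_TC.continuous_map_uniformly_Cauchy_limit)
    show "Met_TC.mcomplete TYPE(real)" by (simp add: complete_UNIV)
    show "\<forall>\<^sub>F n in sequentially. continuous_map \<tau> Met_TC.mtopology (G n)"
      using G(1) by (simp add: cont_lip_def)
    show "\<exists>N. \<forall>m n x. N \<le> m \<longrightarrow> N \<le> n \<longrightarrow> x \<in> topspace \<tau> \<longrightarrow> dist (G m x) (G n x) < \<epsilon>"
      if \<epsilon>: "0 < \<epsilon>" for \<epsilon>
    proof -
      obtain N where N: "e N < \<epsilon> / 8"
        using order_tendstoD(2)[OF e0, of "\<epsilon> / 8"] \<epsilon>
        by (auto simp: eventually_sequentially)
      have "dist (G m x) (G n x) < \<epsilon>" if "N \<le> m" "N \<le> n" for m n x
        using G_le[OF that(1), of x] G_le[OF that(2), of x] N by (simp add: dist_real_def)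
      then show ?thesis by blast
    qed
  qed (auto simp: mtopology_is_euclidean)
  have lim: "(\<lambda>n. G n x) \<longlonglongrightarrow> \<phi> x" if "x \<in> topspace \<tau>" for x
    unfolding tendsto_iff using \<phi>(2) that by (fast elim: eventually_mono)
  have "\<phi> y = f y" if "y \<in> K" for y
  proof (rule LIMSEQ_unique[OF lim])
    show "(\<lambda>n. G n y) \<longlonglongrightarrow> f y"
    proof (rule Lim_transform_bound[OF _ e0, THEN LIM_zero_cancel])
      show "\<forall>\<^sub>F n in sequentially. norm (G n y - f y) \<le> norm (e n)"
        using G(2)[OF that] e(1) by (intro always_eventually) (simp add: less_imp_le)
    qed
  qed (use that KX in blast)
  moreover have "lip_on d L (topspace \<tau>) \<phi>"
    by (rule lip_on_limit[OF _ lim]) (use G(1) in \<open>auto simp: cont_lip_def\<close>)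
  ultimately show ?thesis using \<phi>(1) by (auto simp: cont_lip_def)
qed

text \<open>Maxima and minima with constants keep the Lipschitz constant, so truncation is free. The
  interval form serves both cutoffs with values in \<open>{0..1}\<close> and symmetric bounds
  \<open>{- M..M}\<close>.\<close>

lemma Lip_b_extension:
  assumes K: "compactin \<tau> K" and L: "0 < L" and "a \<le> c"
    and f: "continuous_map (subtopology \<tau> K) euclideanreal f" "lip_on d L K f"
      "\<And>x. x \<in> K \<Longrightarrow> f x \<in> {a..c}"
  obtains F where "F \<in> Lip_b \<tau> d" "lip_on d L (topspace \<tau>) F"
    "\<And>x. x \<in> topspace \<tau> \<Longrightarrow> F x \<in> {a..c}" "\<And>x. x \<in> K \<Longrightarrow> F x = f x"
proof -
  have KX: "K \<subseteq> topspace \<tau>" using compactin_subset_topspace[OF K] .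
  obtain \<phi> where \<phi>: "\<phi> \<in> cont_lip \<tau> d L" "\<And>y. y \<in> K \<Longrightarrow> \<phi> y = f y"
    using exact_extension[OF K L f(1,2)] by blast
  let ?\<phi> = "\<lambda>x. max a (min c (\<phi> x))"
  have c: "?\<phi> \<in> cont_lip \<tau> d L"
    using \<phi>(1) L by (intro cont_lip_max cont_lip_min cont_lip_const) auto
  show ?thesis
  proof (rule that)
    show "restrict ?\<phi> (topspace \<tau>) \<in> Lip_b \<tau> d"
      using c L \<open>a \<le> c\<close> by (intro Lip_bI[OF ext_distance, of _ "\<bar>a\<bar> + \<bar>c\<bar>" L]) (auto simp: cont_lip_def)
    show "lip_on d L (topspace \<tau>) (restrict ?\<phi> (topspace \<tau>))"
      using c lip_on_cong[of "topspace \<tau>" "restrict ?\<phi> (topspace \<tau>)" ?\<phi> d L] by (simp add: cont_lip_def)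
  qed (use \<open>a \<le> c\<close> \<phi>(2) f(3) KX in \<open>force simp: subset_iff\<close>)+
qed

text \<open>Lower semicontinuity of \<open>d\<close> in one variable, as a supremum of continuous
  functions. It makes the sets of points at a definite distance from a countable set Borel.\<close>

lemma open_distance_greater:
  assumes "c \<in> topspace \<tau>"
  shows "openin \<tau> {x \<in> topspace \<tau>. r < d x c}"
proof -
  have "{x \<in> topspace \<tau>. r < d x c} =
      (\<Union>\<phi>\<in>Lip_b \<tau> d \<inter> cont_lip \<tau> d 1. {x \<in> topspace \<tau>. r < ennreal \<bar>\<phi> x - \<phi> c\<bar>})"
    using less_distance_iff[OF _ assms] by blast
  moreover have "openin \<tau> {x \<in> topspace \<tau>. r < ennreal \<bar>\<phi> x - \<phi> c\<bar>}"
    if "\<phi> \<in> cont_lip \<tau> d 1" for \<phi>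
  proof -
    have "continuous_map euclideanreal euclidean (\<lambda>t. ennreal \<bar>t - \<phi> c\<bar>)"
      unfolding continuous_map_iff_continuous2 by (intro continuous_on_ennreal continuous_intros)
    then have "continuous_map \<tau> euclidean ((\<lambda>t. ennreal \<bar>t - \<phi> c\<bar>) \<circ> \<phi>)"
      using that by (intro continuous_map_compose) (auto simp: cont_lip_def)
    from openin_continuous_map_preimage[OF this, of "{r<..}"] show ?thesis by simp
  qed
  ultimately show ?thesis by auto
qed

end

subsection \<open>Weak-star and pointwise topologies\<close>

lemma continuous_map_initial_topology_iff:
  fixes T :: "'c topology" and Y :: "'b set"
  shows "continuous_map T (initial_topology Y F) b \<longleftrightarrow>
     b ` topspace T \<subseteq> Y \<and> (\<forall>\<phi>\<in>F. continuous_map T euclideanreal (\<lambda>x. \<phi> (b x)))"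
proof -
  have *: "b -` (Y \<inter> \<phi> -` U) \<inter> topspace T = {x \<in> topspace T. \<phi> (b x) \<in> U}"
    if "b ` topspace T \<subseteq> Y" for \<phi> :: "'b \<Rightarrow> real" and U
    using that by auto
  have whole: "b -` Y \<inter> topspace T = topspace T" if "b ` topspace T \<subseteq> Y"
    using that by auto
  have un: "\<Union>(insert Y {Y \<inter> f -` U |f U. f \<in> F \<and> open U}) = Y" by auto
  show ?thesis
  proof (cases "b ` topspace T \<subseteq> Y")
    case True
    have "continuous_map T (initial_topology Y F) b \<longleftrightarrow>
        (\<forall>\<phi>\<in>F. \<forall>U. open U \<longrightarrow> openin T (b -` (Y \<inter> \<phi> -` U) \<inter> topspace T))"
      unfolding initial_topology_def continuous_on_generated_topo_iff un
      using True by (simp del: vimage_Int add: whole[OF True]) blast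
    then show ?thesis
      unfolding *[OF True] using True by (simp add: continuous_map_def)
  next
    case False
    then show ?thesis
      unfolding initial_topology_def continuous_on_generated_topo_iff un by simp
  qed
qed

lemma limitin_initial_topology_iff:
  "limitin (initial_topology Y F) s l G \<longleftrightarrow>
     l \<in> Y \<and> (\<forall>\<^sub>F n in G. s n \<in> Y) \<and> (\<forall>\<phi>\<in>F. ((\<lambda>n. \<phi> (s n)) \<longlongrightarrow> \<phi> l) G)"
    (is "?lhs \<longleftrightarrow> ?rhs")
proof
  assume lhs: ?lhs
  have open_Y: "openin (initial_topology Y F) Y"
    unfolding initial_topology_def by (rule topology_generated_by_Basis) simp
  have "l \<in> Y" using limitin_topspace[OF lhs] by simp
  moreover have "((\<lambda>n. \<phi> (s n)) \<longlongrightarrow> \<phi> l) G" if "\<phi> \<in> F" for \<phi>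
    unfolding tendsto_def
  proof (intro allI impI)
    fix U assume "open U" "\<phi> l \<in> U"
    then have "openin (initial_topology Y F) (Y \<inter> \<phi> -` U)"
      unfolding initial_topology_def using that by (intro topology_generated_by_Basis) blast
    then have "\<forall>\<^sub>F n in G. s n \<in> Y \<inter> \<phi> -` U"
      using lhs \<open>\<phi> l \<in> U\<close> \<open>l \<in> Y\<close> unfolding limitin_def by blast
    then show "\<forall>\<^sub>F n in G. \<phi> (s n) \<in> U"
      by (rule eventually_mono) simp
  qed
  ultimately show ?rhs
    using lhs open_Y by (auto simp: limitin_def)
next
  assume rhs: ?rhs
  let ?B = "insert Y {Y \<inter> f -` U |f U. f \<in> F \<and> open U}"
  have "l \<in> U \<longrightarrow> (\<forall>\<^sub>F n in G. s n \<in> U)" if "generate_topology_on ?B U" for U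
    using that
  proof induction
    case (Int a b)
    then show ?case by (auto simp: eventually_conj_iff)
  next
    case (UN K)
    show ?case
    proof
      assume "l \<in> \<Union>K"
      then obtain k where "k \<in> K" "\<forall>\<^sub>F n in G. s n \<in> k" using UN by auto
      then show "\<forall>\<^sub>F n in G. s n \<in> \<Union>K" by (auto elim: eventually_mono)
    qed
  next
    case (Basis U)
    then consider "U = Y" | \<phi> V where "\<phi> \<in> F" "open V" "U = Y \<inter> \<phi> -` V" by auto
    then show ?case
    proof cases
      case 2
      have "\<phi> l \<in> V \<longrightarrow> (\<forall>\<^sub>F n in G. \<phi> (s n) \<in> V)"
        using rhs 2 by (auto simp: tendsto_def)
      then show ?thesis using rhs 2 by (auto simp: eventually_conj_iff)
    qed (use rhs in simp)
  qed simp
  then show ?lhs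
    using rhs by (simp add: limitin_def initial_topology_def openin_topology_generated_by_iff)
qed

lemma L_infinity_integrable:
  assumes "h \<in> L_infinity m" "integrable m g"
  shows "integrable m (\<lambda>x. h x * g x)"
proof -
  obtain C where C: "AE x in m. \<bar>h x\<bar> \<le> C" and [measurable]: "h \<in> borel_measurable m"
    using assms(1) by (auto simp: L_infinity_def)
  have [measurable]: "g \<in> borel_measurable m" using assms(2) by simp
  show ?thesis
  proof (rule Bochner_Integration.integrable_bound)
    show "integrable m (\<lambda>x. C * g x)" using assms(2) by simp
    show "AE x in m. norm (h x * g x) \<le> norm (C * g x)"
      using C by eventually_elim (auto simp: abs_mult intro!: mult_right_mono)
  qed measurable
qed

lemma limitin_weak_star_iff:
  "limitin (weak_star_topology m) s l G \<longleftrightarrow> l \<in> L_infinity m \<and> (\<forall>\<^sub>F n in G. s n \<in> L_infinity m) \<and>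
     (\<forall>g. integrable m g \<longrightarrow> ((\<lambda>n. \<integral>x. s n x * g x \<partial>m) \<longlongrightarrow> (\<integral>x. l x * g x \<partial>m)) G)"
  unfolding weak_star_topology_def limitin_initial_topology_iff by auto

lemma continuous_map_weak_star_iff:
  "continuous_map T (weak_star_topology m) b \<longleftrightarrow> b ` topspace T \<subseteq> L_infinity m \<and>
     (\<forall>g. integrable m g \<longrightarrow> continuous_map T euclideanreal (\<lambda>f. \<integral>x. b f x * g x \<partial>m))"
  unfolding weak_star_topology_def continuous_map_initial_topology_iff by auto

lemma limitin_ball_pointwise_iff:
  "limitin (ball_pointwise_topology \<tau> d) s l G \<longleftrightarrow> l \<in> Lip_b_ball \<tau> d \<and>
     (\<forall>\<^sub>F n in G. s n \<in> Lip_b_ball \<tau> d) \<and> (\<forall>x\<in>topspace \<tau>. ((\<lambda>n. s n x) \<longlongrightarrow> l x) G)"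
proof -
  have "Lip_b_ball \<tau> d \<subseteq> extensional (topspace \<tau>)"
    by (auto simp: Lip_b_ball_def Lip_b_def)
  then show ?thesis
    unfolding ball_pointwise_topology_def limitin_subtopology limitin_componentwise
    by (auto simp: PiE_def elim: eventually_mono)
qed

text \<open>A basic open set of a product constrains only finitely many coordinates, so agreement
  with \<open>f\<close> at those points puts \<open>h\<close> into the neighbourhood. This is where
  part (i) uses full rather than sequential continuity.\<close>

lemma weak_star_continuous_finite_nbhd:
  assumes b: "weak_star_continuous \<tau> d m b" and g: "integrable m g"
    and f: "f \<in> Lip_b_ball \<tau> d" and \<epsilon>: "0 < \<epsilon>"
  shows "\<exists>F. finite F \<and> F \<subseteq> topspace \<tau> \<and>
    (\<forall>h\<in>Lip_b_ball \<tau> d. (\<forall>x\<in>F. h x = f x) \<longrightarrow>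
      \<bar>(\<integral>x. b h x * g x \<partial>m) - (\<integral>x. b f x * g x \<partial>m)\<bar> < \<epsilon>)"
proof -
  let ?t = "\<lambda>h. \<integral>x. b h x * g x \<partial>m"
  have "continuous_map (ball_pointwise_topology \<tau> d) euclideanreal ?t"
    using b g by (simp add: weak_star_continuous_def continuous_map_weak_star_iff)
  from openin_continuous_map_preimage[OF this, of "ball (?t f) \<epsilon>"]
  have "openin (ball_pointwise_topology \<tau> d) {h \<in> Lip_b_ball \<tau> d. ?t h \<in> ball (?t f) \<epsilon>}"
    by simp
  then obtain V where V: "openin (powertop_real (topspace \<tau>)) V"
    "{h \<in> Lip_b_ball \<tau> d. ?t h \<in> ball (?t f) \<epsilon>} = V \<inter> Lip_b_ball \<tau> d"
    unfolding ball_pointwise_topology_def openin_subtopology by blast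
  have "f \<in> {h \<in> Lip_b_ball \<tau> d. ?t h \<in> ball (?t f) \<epsilon>}" using f \<epsilon> by simp
  then have "f \<in> V" unfolding V(2) by blast
  from product_topology_open_contains_basis[OF V(1) this]
  obtain B where B: "f \<in> (\<Pi>\<^sub>E i\<in>topspace \<tau>. B i)" "finite {i. B i \<noteq> UNIV}"
    "(\<Pi>\<^sub>E i\<in>topspace \<tau>. B i) \<subseteq> V"
    unfolding topspace_euclidean by blast
  show ?thesis
  proof (intro exI conjI ballI impI)
    show "finite ({i. B i \<noteq> UNIV} \<inter> topspace \<tau>)" using B(2) by simp
    fix h assume h: "h \<in> Lip_b_ball \<tau> d"
      and eq: "\<forall>x\<in>{i. B i \<noteq> UNIV} \<inter> topspace \<tau>. h x = f x"
    have "h \<in> (\<Pi>\<^sub>E i\<in>topspace \<tau>. B i)"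
    proof (rule PiE_I)
      fix i assume i: "i \<in> topspace \<tau>"
      show "h i \<in> B i"
      proof (cases "B i = UNIV")
        case False
        then show ?thesis using eq i B(1) by (simp add: PiE_mem)
      qed simp
    next
      show "h i = undefined" if "i \<notin> topspace \<tau>" for i
        using h that by (simp add: Lip_b_ball_def Lip_b_def extensional_def)
    qed
    then have "?t h \<in> ball (?t f) \<epsilon>" using B(3) h V(2) by blast
    then show "\<bar>?t h - ?t f\<bar> < \<epsilon>" by (simp add: dist_real_def abs_minus_commute)
  qed simp
qed

text \<open>Functions in the ball are 1-Lipschitz, so on it pointwise convergence is convergence on a
  countable dense set; this makes the domain first countable.\<close>

lemma weak_star_seq_continuous_imp_continuous:
  assumes d: "ext_distance_on (topspace \<tau>) d" and sep: "d_separable d (topspace \<tau>)"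
    and b: "weak_star_seq_continuous \<tau> d m b"
  shows "weak_star_continuous \<tau> d m b"
proof -
  obtain C where C: "countable C" "C \<subseteq> topspace \<tau>"
    "\<And>x \<epsilon>. x \<in> topspace \<tau> \<Longrightarrow> 0 < \<epsilon> \<Longrightarrow> \<exists>c\<in>C. d x c < \<epsilon>"
    using sep by (auto simp: d_separable_def)
  obtain c :: "nat \<Rightarrow> 'a" where c: "C \<subseteq> range c"
    using C(1) by (metis empty_subsetI order_refl uncountable_def)
  have Linf: "b f \<in> L_infinity m" if "f \<in> Lip_b \<tau> d" for f
    using b that by (simp add: weak_star_seq_continuous_def)
  have lim: "(\<lambda>n. \<integral>x. b (s n) x * g x \<partial>m) \<longlonglongrightarrow> (\<integral>x. b f x * g x \<partial>m)"
    if "integrable m g" "\<And>n. s n \<in> Lip_b_ball \<tau> d" "f \<in> Lip_b_ball \<tau> d"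
      "\<And>x. x \<in> topspace \<tau> \<Longrightarrow> (\<lambda>n. s n x) \<longlonglongrightarrow> f x" for g s f
  proof -
    have "limitin (ball_pointwise_topology \<tau> d) s f sequentially"
      using that by (simp add: limitin_ball_pointwise_iff)
    then have "limitin (weak_star_topology m) (b \<circ> s) (b f) sequentially"
      using b that(2) unfolding weak_star_seq_continuous_def by blast
    then show ?thesis using that(1) by (simp add: limitin_weak_star_iff)
  qed
  have "continuous_map (ball_pointwise_topology \<tau> d) Met_TC.mtopology (\<lambda>f. \<integral>x. b f x * g x \<partial>m)"
    (is "continuous_map _ _ ?t") if g: "integrable m g" for g
    unfolding Met_TC.continuous_map_to_metric topspace_ball_pointwise_topology
  proof (intro ballI allI impI, rule ccontr)
    fix f and \<epsilon> :: real
    assume f: "f \<in> Lip_b_ball \<tau> d" and \<epsilon>: "0 < \<epsilon>"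
      and not_cont: "\<not> (\<exists>U. openin (ball_pointwise_topology \<tau> d) U \<and> f \<in> U \<and>
        (\<forall>h\<in>U. ?t h \<in> Met_TC.mball (?t f) \<epsilon>))"
    \<comment> \<open>A countable system of neighbourhoods of \<open>f\<close>: the point
      \<open>c i\<close> is controlled from \<open>n = Suc i\<close> on, with tolerance tending to
      0. The enumeration only covers \<open>C\<close> and may leave the space, hence the test on
      \<open>c i\<close>.\<close>
    define U where "U n = {h \<in> Lip_b_ball \<tau> d. \<forall>i\<in>{i. i < n \<and> c i \<in> topspace \<tau>}.
      \<bar>h (c i) - f (c i)\<bar> < 1 / Suc n}" for n
    have "openin (ball_pointwise_topology \<tau> d) (U n)" for n
    proof -
      have *: "openin (powertop_real (topspace \<tau>))
          {h \<in> topspace (powertop_real (topspace \<tau>)). h (c i) \<in> ball (f (c i)) (1 / Suc n)}"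
        if "c i \<in> topspace \<tau>" for i
        by (rule openin_continuous_map_preimage[OF continuous_map_product_projection[OF that]]) simp
      let ?P = "powertop_real (topspace \<tau>)"
      let ?W = "\<lambda>i. {h \<in> topspace ?P. h (c i) \<in> ball (f (c i)) (1 / Suc n)}"
      let ?V = "topspace ?P \<inter> (\<Inter>i\<in>{i. i < n \<and> c i \<in> topspace \<tau>}. ?W i)"
      have "openin ?P ?V"
      proof (rule openin_Int_Inter)
        show "openin ?P V" if "V \<in> ?W ` {i. i < n \<and> c i \<in> topspace \<tau>}" for V
          using that * by blast
        show "openin ?P (topspace ?P)" by (rule openin_topspace)
      qed simp
      then have "openin (ball_pointwise_topology \<tau> d) (Lip_b_ball \<tau> d \<inter> ?V)"
        unfolding ball_pointwise_topology_def by (rule openin_subtopology_Int2)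
      also have "Lip_b_ball \<tau> d \<inter> ?V = U n"
        by (auto simp: U_def dist_real_def abs_minus_commute Lip_b_ball_def Lip_b_def PiE_def)
      finally show ?thesis .
    qed
    moreover have "f \<in> U n" for n using f by (simp add: U_def)
    ultimately have "\<exists>h. h \<in> U n \<and> ?t h \<notin> Met_TC.mball (?t f) \<epsilon>" for n
      using not_cont by blast
    then obtain h where h: "\<And>n. h n \<in> U n" "\<And>n. ?t (h n) \<notin> Met_TC.mball (?t f) \<epsilon>" by metis
    have ball: "h n \<in> Lip_b_ball \<tau> d" for n using h(1) by (simp add: U_def)
    \<comment> \<open>Both functions are 1-Lipschitz, so a nearby point of \<open>C\<close> costs
      \<open>r / 4\<close> for each, and the difference at that point costs another
      \<open>r / 4\<close>.\<close>
    have "(\<lambda>n. h n x) \<longlonglongrightarrow> f x" if x: "x \<in> topspace \<tau>" for x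
    proof (rule LIMSEQ_I)
      fix r :: real assume r: "0 < r"
      then obtain y where y: "y \<in> C" "d x y < ennreal (r / 4)"
        using C(3)[OF x, of "ennreal (r / 4)"] by auto
      then obtain i where i: "y = c i" using c by auto
      have yX: "y \<in> topspace \<tau>" using y C(2) by auto
      have fin: "d x y < \<infinity>" using y(2) by (metis ennreal_less_top infinity_ennreal_def less_trans)
      have "enn2real (d x y) < r / 4"
        using y(2) r by (metis enn2real_less_iff fin infinity_ennreal_def order_less_imp_le zero_less_divide_iff zero_less_numeral)
      then have near: "\<bar>\<phi> x - \<phi> y\<bar> < r / 4" if "\<phi> \<in> Lip_b_ball \<tau> d" for \<phi>
        using lip_onD[OF Lip_b_ballD(2)[OF d that] x yX fin] by simp
      obtain N where N: "1 / real (Suc N) < r / 4"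
        using nat_approx_posE[of "r / 4"] r by auto
      have "norm (h n x - f x) < r" if n: "n \<ge> max N (Suc i)" for n
      proof -
        have "\<bar>h n y - f y\<bar> < 1 / Suc n" using h(1)[of n] n yX i by (simp add: U_def)
        also have "\<dots> \<le> 1 / Suc N" using n by (intro divide_left_mono) auto
        finally show ?thesis
          using near[OF ball[of n]] near[OF f] N unfolding real_norm_def by linarith
      qed
      then show "\<exists>no. \<forall>n\<ge>no. norm (h n x - f x) < r" by blast
    qed
    from lim[OF g ball f this]
    have "\<forall>\<^sub>F n in sequentially. dist (?t (h n)) (?t f) < \<epsilon>" using \<epsilon> by (simp add: tendsto_iff)
    then show False using h(2) by (simp add: dist_commute)
  qed
  then have "continuous_map (ball_pointwise_topology \<tau> d) (weak_star_topology m) b"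
    unfolding continuous_map_weak_star_iff mtopology_is_euclidean topspace_ball_pointwise_topology
    using Linf Lip_b_ballD(1)[OF d] by blast
  then show ?thesis
    using Linf by (simp add: weak_star_continuous_def)
qed

text \<open>\<open>C\<close> is only close to \<open>E\<close>, whereas separability asks for a
  countable dense set inside \<open>E\<close>. For each center and radius a point of
  \<open>E\<close> is picked in the corresponding ball, and the triangle inequality doubles the
  radius.\<close>

lemma d_separable_of_countable_dense:
  assumes d: "ext_distance_on X d" and C: "countable C" "C \<subseteq> X" and E: "E \<subseteq> X"
    and approx: "\<And>x n. x \<in> E \<Longrightarrow> \<exists>c\<in>C. d x c \<le> ennreal (1 / Suc n)"
  shows "d_separable d E"
proof -
  define p where "p c n = (SOME y. y \<in> E \<and> d y c \<le> ennreal (1 / Suc n))" for c and n :: nat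
  \<comment> \<open>The intersection with \<open>E\<close> discards the arbitrary values of
    \<open>SOME\<close> where the ball misses \<open>E\<close>.\<close>
  let ?D = "(\<lambda>(c, n). p c n) ` (C \<times> UNIV) \<inter> E"
  have "\<exists>y\<in>?D. d x y < \<epsilon>" if x: "x \<in> E" and \<epsilon>: "0 < \<epsilon>" for x \<epsilon>
  proof -
    obtain z where z: "0 < z" "z < \<epsilon>" using dense[OF \<epsilon>] by blast
    then obtain e where e: "0 < e" "ennreal e < \<epsilon>" by (cases z) auto
    obtain n where n: "1 / real (Suc n) < e / 2"
      using nat_approx_posE[of "e / 2"] e by auto
    obtain c where c: "c \<in> C" "d x c \<le> ennreal (1 / Suc n)" using approx[OF x] by blast
    then have p: "p c n \<in> E" "d (p c n) c \<le> ennreal (1 / Suc n)"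
      using someI[of "\<lambda>y. y \<in> E \<and> d y c \<le> ennreal (1 / Suc n)" x] x by (auto simp: p_def)
    have "d x (p c n) \<le> d x c + d c (p c n)" "d c (p c n) = d (p c n) c"
      using d subsetD[OF E x] subsetD[OF E p(1)] subsetD[OF C(2) c(1)]
      unfolding ext_distance_on_def by metis+
    then have "d x (p c n) \<le> ennreal (1 / Suc n) + ennreal (1 / Suc n)"
      using c(2) p(2) by (metis add_mono order_trans)
    also have "\<dots> \<le> ennreal e"
      using n by (subst ennreal_plus[symmetric]) (auto intro!: ennreal_leI)
    finally show ?thesis using e(2) p(1) c(1) by force
  qed
  then show ?thesis
    unfolding d_separable_def using C(1) by (intro exI[of _ ?D]) auto
qed

subsection \<open>Vanishing off the separable component\<close>

lemma derivation_lincomb: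
  "lipschitz_derivation \<tau> d m b \<Longrightarrow> f \<in> Lip_b \<tau> d \<Longrightarrow> g \<in> Lip_b \<tau> d \<Longrightarrow>
    AE x in m. b (\<lambda>y\<in>topspace \<tau>. \<alpha> * f y + \<beta> * g y) x = \<alpha> * b f x + \<beta> * b g x"
  by (simp add: lipschitz_derivation_def)

lemma derivation_mult:
  "lipschitz_derivation \<tau> d m b \<Longrightarrow> f \<in> Lip_b \<tau> d \<Longrightarrow> g \<in> Lip_b \<tau> d \<Longrightarrow>
    AE x in m. b (\<lambda>y\<in>topspace \<tau>. f y * g y) x = f x * b g x + g x * b f x"
  by (simp add: lipschitz_derivation_def)

lemma derivation_cmult:
  assumes "lipschitz_derivation \<tau> d m b" "f \<in> Lip_b \<tau> d"
  shows "AE x in m. b (\<lambda>y\<in>topspace \<tau>. \<alpha> * f y) x = \<alpha> * b f x"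
  using derivation_lincomb[OF assms assms(2), of \<alpha> 0] by simp

lemma derivation_diff:
  assumes "lipschitz_derivation \<tau> d m b" "f \<in> Lip_b \<tau> d" "g \<in> Lip_b \<tau> d"
  shows "AE x in m. b (\<lambda>y\<in>topspace \<tau>. f y - g y) x = b f x - b g x"
  using derivation_lincomb[OF assms, of 1 "-1"] by simp

locale emtm = emt \<tau> d for \<tau> :: "'a topology" and d :: "'a \<Rightarrow> 'a \<Rightarrow> ennreal" +
  fixes m :: "'a measure"
  assumes radon: "radon_measure_on \<tau> m"

sublocale emtm \<subseteq> finite_measure m
  using radon unfolding radon_measure_on_def by blast

context emtm
begin

lemma space_m: "space m = topspace \<tau>"
  using radon unfolding radon_measure_on_def by blast

lemma openin_sets: "openin \<tau> U \<Longrightarrow> U \<in> sets m"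
  using radon unfolding radon_measure_on_def by (metis mem_Collect_eq sigma_sets.Basic)

lemma closedin_sets: "closedin \<tau> U \<Longrightarrow> U \<in> sets m"
  by (metis closedin_def double_diff openin_sets order_refl sets.compl_sets space_m)

lemma compactin_sets: "compactin \<tau> K \<Longrightarrow> K \<in> sets m"
  by (simp add: Hausdorff closedin_sets compactin_imp_closedin)

lemma emeasure_inner:
  "A \<in> sets m \<Longrightarrow> emeasure m A = (SUP K\<in>{K. compactin \<tau> K \<and> K \<subseteq> A}. emeasure m K)"
  using radon unfolding radon_measure_on_def by blast

text \<open>Inner regularity reduces the vanishing claim to compact sets, on which cutoffs are
  available.\<close>

lemma null_if_compacts_null:
  assumes "A \<in> sets m" "\<And>K. compactin \<tau> K \<Longrightarrow> K \<subseteq> A \<Longrightarrow> emeasure m K = 0"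
  shows "emeasure m A = 0"
proof -
  have "emeasure m A \<le> 0"
    unfolding emeasure_inner[OF assms(1)] by (rule SUP_least) (use assms(2) in simp)
  then show ?thesis by simp
qed

lemma continuous_map_measurable:
  assumes "continuous_map \<tau> euclideanreal f"
  shows "f \<in> borel_measurable m"
proof (rule borel_measurableI)
  fix U :: "real set" assume "open U"
  then have "openin \<tau> {x \<in> topspace \<tau>. f x \<in> U}"
    using assms by (simp add: continuous_map_def)
  moreover have "{x \<in> topspace \<tau>. f x \<in> U} = f -` U \<inter> space m" by (auto simp: space_m)
  ultimately show "f -` U \<inter> space m \<in> sets m" by (metis openin_sets)
qed

lemma Lip_b_measurable: "f \<in> Lip_b \<tau> d \<Longrightarrow> f \<in> borel_measurable m"
  by (simp add: Lip_b_def continuous_map_measurable)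

lemma derivation_zero:
  assumes "lipschitz_derivation \<tau> d m b"
  shows "AE x in m. b (\<lambda>y\<in>topspace \<tau>. 0) x = 0"
proof -
  have "(\<lambda>y\<in>topspace \<tau>. 0) \<in> Lip_b \<tau> d"
    by (rule Lip_bI[OF ext_distance, of _ 0 0]) (simp_all add: lip_on_const)
  from derivation_cmult[OF assms this, of 0] show ?thesis by simp
qed

lemma zero_in_ball: "(\<lambda>y\<in>topspace \<tau>. 0) \<in> Lip_b_ball \<tau> d"
proof (rule Lip_b_ballI[OF ext_distance, of _ 0 0])
  show "(\<lambda>y\<in>topspace \<tau>. 0) \<in> Lip_b \<tau> d"
    by (rule Lip_bI[OF ext_distance, of _ 0 0]) (simp_all add: lip_on_const)
qed (simp_all add: lip_on_def)

text \<open>\<open>K\<close> and \<open>F\<close> are disjoint and compact, hence clopen in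
  \<open>K \<union> F\<close>, so the indicator of \<open>K\<close> is continuous there. It is
  \<open>1 / r\<close>-Lipschitz because jumps occur only over distances above \<open>r\<close>, and
  then it extends. The constant depends on \<open>r\<close> alone, not on the number of points in
  \<open>F\<close>.\<close>

lemma ex_cutoff:
  assumes K: "compactin \<tau> K" and F: "finite F" "F \<subseteq> topspace \<tau>" and r: "0 < r"
    and far: "\<And>x y. x \<in> K \<Longrightarrow> y \<in> F \<Longrightarrow> ennreal r < d x y"
  obtains u where "u \<in> Lip_b \<tau> d" "lip_on d (1 / r) (topspace \<tau>) u"
    "\<And>x. x \<in> topspace \<tau> \<Longrightarrow> u x \<in> {0..1}" "\<And>x. x \<in> K \<Longrightarrow> u x = 1" "\<And>x. x \<in> F \<Longrightarrow> u x = 0"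
proof -
  let ?T = "subtopology \<tau> (K \<union> F)" and ?k = "indicator K :: 'a \<Rightarrow> real"
  have KX: "K \<subseteq> topspace \<tau>" using compactin_subset_topspace[OF K] .
  have top: "topspace ?T = K \<union> F" using KX F by auto
  have F': "compactin \<tau> F" by (simp add: F finite_imp_compactin)
  have disj: "x \<notin> F" if "x \<in> K" for x
  proof
    assume "x \<in> F"
    with far[OF that this] have "d x x \<noteq> 0" by auto
    then show False using ext_distance that KX by (auto simp: ext_distance_on_def)
  qed
  have closed: "closedin ?T K" "closedin ?T F"
    using compactin_imp_closedin[OF Hausdorff] K F' by (auto intro: closedin_subset_topspace)
  have "K \<union> F - F = K" "K \<union> F - K = F" using disj by auto
  then have opens: "openin ?T K" "openin ?T F"
    using openin_diff[OF openin_topspace closed(1)] openin_diff[OF openin_topspace closed(2)]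
    unfolding top by metis+
  have "openin ?T {x \<in> topspace ?T. ?k x \<in> U}" for U
  proof -
    have "{x \<in> topspace ?T. ?k x \<in> U} = (if 1 \<in> U then K else {}) \<union> (if 0 \<in> U then F else {})"
      unfolding top using disj by (auto simp: indicator_def split: if_splits)
    moreover have "openin ?T (if P then V else {})" if "openin ?T V" for V P using that by simp
    ultimately show ?thesis using opens openin_Un by metis
  qed
  then have cont: "continuous_map ?T euclideanreal ?k"
    by (simp add: continuous_map_def)
  have one: "1 \<le> 1 / r * enn2real (d x y)" if "x \<in> K" "y \<in> F" "d x y < \<infinity>" for x y
  proof -
    have "r < enn2real (d x y)"
      using far[OF that(1,2)] that(3) r by (cases "d x y") (auto simp: ennreal_less_iff)
    then show ?thesis using r by (simp add: pos_le_divide_eq)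
  qed
  have sym: "d x y = d y x" if "x \<in> topspace \<tau>" "y \<in> topspace \<tau>" for x y
    using that ext_distance unfolding ext_distance_on_def by metis
  have lip: "lip_on d (1 / r) (K \<union> F) ?k"
    unfolding lip_on_def
  proof (intro ballI impI)
    fix x y assume xy: "x \<in> K \<union> F" "y \<in> K \<union> F" "d x y < \<infinity>"
    consider "x \<in> K" "y \<in> F" | "x \<in> F" "y \<in> K" | "x \<in> K \<longleftrightarrow> y \<in> K"
      using xy by blast
    then show "\<bar>?k x - ?k y\<bar> \<le> 1 / r * enn2real (d x y)"
    proof cases
      case 1
      then show ?thesis using one[OF 1 xy(3)] 1 disj[of y] by (auto simp: indicator_def)
    next
      case 2
      then have "d x y = d y x" using sym KX F by blast
      then show ?thesis using one[OF 2(2,1)] xy(3) 2 disj[of x] by (auto simp: indicator_def)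
    qed (use r in \<open>simp add: indicator_def\<close>)
  qed
  have "compactin \<tau> (K \<union> F)" using K F' by (rule compactin_Un)
  then obtain u where u: "u \<in> Lip_b \<tau> d" "lip_on d (1 / r) (topspace \<tau>) u"
    "\<And>x. x \<in> topspace \<tau> \<Longrightarrow> u x \<in> {0..1}" "\<And>x. x \<in> K \<union> F \<Longrightarrow> u x = ?k x"
    by (rule Lip_b_extension[of "K \<union> F" "1 / r" 0 1 ?k])
      (use r lip cont in \<open>simp_all add: indicator_def\<close>)
  show thesis
  proof (rule that[OF u(1,2,3)])
    show "u x = 1" if "x \<in> K" for x using u(4)[of x] that by simp
    show "u x = 0" if "x \<in> F" for x using u(4)[of x] that disj[of x] by (auto simp: indicator_def)
  qed
qed

text \<open>Testing continuity at 0 against \<open>g = sgn (b f)\<close> off \<open>S\<close> and against \<open>f g\<close> singles out a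
  countable set \<open>C\<close>. A cutoff \<open>u\<close> equal to 1 on a compact set at positive distance from \<open>C\<close> and
  vanishing on finitely many points of \<open>C\<close> makes \<open>\<integral> b(u f) g\<close> and \<open>\<integral> b(u) f g\<close> small, hence also
  \<open>\<integral> u b(f) g\<close> by the Leibniz rule.\<close>

lemma weak_star_continuous_derivation_vanishes:
  assumes S: "maximal_separable_component d m S" and b: "lipschitz_derivation \<tau> d m b"
    and cont: "weak_star_continuous \<tau> d m b" and f: "f \<in> Lip_b \<tau> d"
  shows "AE x in m. x \<in> topspace \<tau> - S \<longrightarrow> b f x = 0"
proof -
  obtain L M where LM: "0 < L" "0 < M" "lip_on d L (topspace \<tau>) f" "\<And>x. x \<in> topspace \<tau> \<Longrightarrow> \<bar>f x\<bar> \<le> M"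
    using Lip_bE[OF ext_distance f] by metis
  have S_sets [measurable]: "S \<in> sets m" using S by (simp add: maximal_separable_component_def)
  have Linf: "b h \<in> L_infinity m" if "h \<in> Lip_b \<tau> d" for h
    using cont that by (simp add: weak_star_continuous_def)
  have [measurable]: "b f \<in> borel_measurable m" "f \<in> borel_measurable m"
    using Linf[OF f] Lip_b_measurable[OF f] by (simp_all add: L_infinity_def)
  have X_sets [measurable]: "topspace \<tau> \<in> sets m" using openin_sets[OF openin_topspace] .
  define g where "g x = indicator (topspace \<tau> - S) x * sgn (b f x)" for x
  have [measurable]: "g \<in> borel_measurable m" unfolding g_def by measurable
  have g: "integrable m g"
    by (rule integrable_const_bound[of _ 1]) (auto simp: g_def indicator_def sgn_if)
  have fg: "integrable m (\<lambda>x. f x * g x)"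
  proof (rule Bochner_Integration.integrable_bound)
    show "integrable m (\<lambda>x. M * g x)" using g by simp
    show "AE x in m. norm (f x * g x) \<le> norm (M * g x)"
      using LM(4) by (intro AE_I2) (auto simp: space_m abs_mult intro!: mult_right_mono order_trans[OF LM(4)])
  qed measurable
  have small: "\<exists>F. finite F \<and> F \<subseteq> topspace \<tau> \<and> (\<forall>h\<in>Lip_b_ball \<tau> d. (\<forall>x\<in>F. h x = 0) \<longrightarrow>
      \<bar>\<integral>x. b h x * \<gamma> x \<partial>m\<bar> < \<epsilon>)" if \<gamma>: "integrable m \<gamma>" and "0 < \<epsilon>" for \<gamma> \<epsilon>
  proof -
    let ?z = "\<lambda>y\<in>topspace \<tau>. 0 :: real"
    obtain F where F: "finite F" "F \<subseteq> topspace \<tau>"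
      "\<forall>h\<in>Lip_b_ball \<tau> d. (\<forall>x\<in>F. h x = ?z x) \<longrightarrow>
        \<bar>(\<integral>x. b h x * \<gamma> x \<partial>m) - (\<integral>x. b ?z x * \<gamma> x \<partial>m)\<bar> < \<epsilon>"
      using weak_star_continuous_finite_nbhd[OF cont \<gamma> zero_in_ball \<open>0 < \<epsilon>\<close>] by blast
    have "(\<integral>x. b ?z x * \<gamma> x \<partial>m) = 0"
      using derivation_zero[OF b] by (intro integral_eq_zero_AE) auto
    moreover have "(\<forall>x\<in>F. h x = ?z x) \<longleftrightarrow> (\<forall>x\<in>F. h x = 0)" for h
      using F(2) by (auto simp: subset_iff)
    ultimately show ?thesis using F by auto
  qed
  have "\<exists>F. finite F \<and> F \<subseteq> topspace \<tau> \<and> (\<forall>h\<in>Lip_b_ball \<tau> d. (\<forall>x\<in>F. h x = 0) \<longrightarrow>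
      \<bar>\<integral>x. b h x * g x \<partial>m\<bar> < 1 / Suc n \<and> \<bar>\<integral>x. b h x * (f x * g x) \<partial>m\<bar> < 1 / Suc n)" for n
  proof -
    obtain F F' where "finite F" "F \<subseteq> topspace \<tau>" "finite F'" "F' \<subseteq> topspace \<tau>"
      "\<forall>h\<in>Lip_b_ball \<tau> d. (\<forall>x\<in>F. h x = 0) \<longrightarrow> \<bar>\<integral>x. b h x * g x \<partial>m\<bar> < 1 / Suc n"
      "\<forall>h\<in>Lip_b_ball \<tau> d. (\<forall>x\<in>F'. h x = 0) \<longrightarrow> \<bar>\<integral>x. b h x * (f x * g x) \<partial>m\<bar> < 1 / Suc n"
      using small[OF g, of "1 / Suc n"] small[OF fg, of "1 / Suc n"] by auto
    then show ?thesis by (intro exI[of _ "F \<union> F'"]) auto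
  qed
  from choice[OF allI[OF this]] obtain F where F_all: "\<forall>n. finite (F n) \<and> F n \<subseteq> topspace \<tau> \<and>
      (\<forall>h\<in>Lip_b_ball \<tau> d. (\<forall>x\<in>F n. h x = 0) \<longrightarrow>
        \<bar>\<integral>x. b h x * g x \<partial>m\<bar> < 1 / Suc n \<and> \<bar>\<integral>x. b h x * (f x * g x) \<partial>m\<bar> < 1 / Suc n)" ..
  have F: "finite (F n)" "F n \<subseteq> topspace \<tau>" for n
    using F_all by blast+
  have F_small: "\<bar>\<integral>x. b h x * g x \<partial>m\<bar> < 1 / Suc n" "\<bar>\<integral>x. b h x * (f x * g x) \<partial>m\<bar> < 1 / Suc n"
    if "h \<in> Lip_b_ball \<tau> d" "\<And>x. x \<in> F n \<Longrightarrow> h x = 0" for n h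
  proof -
    have "\<forall>x\<in>F n. h x = 0" using that(2) by (rule ballI)
    with F_all that(1)
    show "\<bar>\<integral>x. b h x * g x \<partial>m\<bar> < 1 / Suc n" "\<bar>\<integral>x. b h x * (f x * g x) \<partial>m\<bar> < 1 / Suc n"
      by metis+
  qed
  define C where "C = (\<Union>n. F n)"
  have C: "countable C" "C \<subseteq> topspace \<tau>"
    unfolding C_def using F(1,2) by (auto intro: countable_finite)
  \<comment> \<open>The gap is required from all of \<open>C\<close> at once. Each
    \<open>F n\<close> lies in \<open>C\<close>, so a cutoff for \<open>F n\<close> on a compact
    part of \<open>A k\<close> is \<open>Suc k\<close>-Lipschitz for every \<open>n\<close>.\<close>
  define A where "A k = {x \<in> topspace \<tau> - S. \<forall>c\<in>C. ennreal (1 / Suc k) < d x c}" for k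
  have A_sets [measurable]: "A k \<in> sets m" for k
  proof -
    let ?U = "\<lambda>c. {x \<in> topspace \<tau>. ennreal (1 / Suc k) < d x c}"
    have "?U c \<in> sets m" if "c \<in> C" for c
      using that C(2) by (intro openin_sets open_distance_greater) blast
    \<comment> \<open>A countable intersection written through complements, which also covers
      \<open>C = {}\<close>.\<close>
    then have "(topspace \<tau> - S) - (\<Union>c\<in>C. topspace \<tau> - ?U c) \<in> sets m"
      using C(1) X_sets S_sets by (intro sets.Diff sets.countable_UN'') auto
    also have "(topspace \<tau> - S) - (\<Union>c\<in>C. topspace \<tau> - ?U c) = A k"
      unfolding A_def by blast
    finally show ?thesis .
  qed
  have on_compact: "AE x in m. x \<in> K \<longrightarrow> b f x = 0" if K: "compactin \<tau> K" "K \<subseteq> A k" for K k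
  proof -
    let ?L = "real (Suc k)"
    \<comment> \<open>Sum of norm bounds for \<open>u\<close>, namely \<open>?L + 1\<close>, and for
      the product of \<open>u\<close> and \<open>f\<close>, namely \<open>L + M * ?L + M\<close>.
      Dividing by \<open>D\<close> puts both into the unit ball, with a factor independent of
      \<open>n\<close>.\<close>
    define D where "D = ?L + 1 + L + M * ?L + M"
    have D: "0 < D" "?L + 1 \<le> D" "L + M * ?L + M \<le> D" using LM by (simp_all add: D_def add_pos_pos)
    have [measurable]: "K \<in> sets m" using compactin_sets[OF K(1)] .
    have bound: "(\<integral>x. indicator K x * \<bar>b f x\<bar> \<partial>m) \<le> 2 * D / Suc n" for n
    proof -
      obtain u where u: "u \<in> Lip_b \<tau> d" "lip_on d (1 / (1 / ?L)) (topspace \<tau>) u"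
        "\<And>x. x \<in> topspace \<tau> \<Longrightarrow> u x \<in> {0..1}" "\<And>x. x \<in> K \<Longrightarrow> u x = 1" "\<And>x. x \<in> F n \<Longrightarrow> u x = 0"
        by (rule ex_cutoff[OF K(1) F(1,2), of "1 / ?L" n]) (use K(2) in \<open>auto simp: A_def C_def\<close>)
      define v where "v = (\<lambda>x\<in>topspace \<tau>. 1 / D * u x)"
      define w where "w = (\<lambda>x\<in>topspace \<tau>. v x * f x)"
      have v_lip: "lip_on d (1 / D * ?L) (topspace \<tau>) v"
        using lip_on_cmult[OF u(2), of "1 / D"] D(1) lip_on_cong[of "topspace \<tau>" v "\<lambda>x. 1 / D * u x" d]
        by (simp add: v_def)
      have v_bound: "0 \<le> v x" "\<bar>v x\<bar> \<le> 1 / D" if "x \<in> topspace \<tau>" for x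
        using u(3)[OF that] D(1) that by (auto simp: v_def divide_right_mono)
      have v_Lip: "v \<in> Lip_b \<tau> d"
        using Lip_b_lincomb[OF ext_distance u(1) u(1), of "1 / D" 0] by (simp add: v_def)
      have v_ball: "v \<in> Lip_b_ball \<tau> d"
        using v_bound(2) D by (intro Lip_b_ballI[OF ext_distance v_Lip _ _ _ v_lip, of "1 / D"])
          (auto simp: add_divide_distrib[symmetric])
      have w_Lip: "w \<in> Lip_b \<tau> d"
        unfolding w_def by (rule Lip_b_mult[OF ext_distance v_Lip f])
      have "lip_on d (1 / D * L + M * (1 / D * ?L)) (topspace \<tau>) (\<lambda>x. v x * f x)"
        by (rule lip_on_mult[OF v_lip v_bound(2) LM(3,4)])
      then have w_lip: "lip_on d (1 / D * L + M * (1 / D * ?L)) (topspace \<tau>) w"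
        using lip_on_cong[of "topspace \<tau>" w "\<lambda>x. v x * f x" d] by (simp add: w_def)
      have w_ball: "w \<in> Lip_b_ball \<tau> d"
      proof (rule Lip_b_ballI[OF ext_distance w_Lip _ _ _ w_lip])
        show "\<bar>w x\<bar> \<le> M / D" if "x \<in> topspace \<tau>" for x
          using mult_mono'[OF v_bound(2)[OF that] LM(4)[OF that]] that by (simp add: w_def abs_mult)
        have "1 / D * L + M * (1 / D * ?L) + M / D = (L + M * ?L + M) / D"
          unfolding add_divide_distrib by simp
        then show "1 / D * L + M * (1 / D * ?L) + M / D \<le> 1" using D by simp
      qed (use D(1) LM in simp_all)
      have v0: "v x = 0" "w x = 0" if "x \<in> F n" for x
        using u(5)[OF that] F(2) that by (auto simp: v_def w_def)
      have [measurable]: "v \<in> borel_measurable m" using Lip_b_measurable[OF v_Lip] .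
      have [measurable]: "b w \<in> borel_measurable m" "b v \<in> borel_measurable m"
        using Linf[OF w_Lip] Linf[OF v_Lip] by (simp_all add: L_infinity_def)
      have int_w: "integrable m (\<lambda>x. b w x * g x)" and int_v: "integrable m (\<lambda>x. b v x * (f x * g x))"
        using L_infinity_integrable Linf w_Lip v_Lip g fg by blast+
      have int_f: "integrable m (\<lambda>x. \<bar>b f x * g x\<bar>)"
        using L_infinity_integrable[OF Linf[OF f] g] by (rule integrable_abs)
      have leib: "AE x in m. b w x * g x - b v x * (f x * g x) = v x * (b f x * g x)"
        using derivation_mult[OF b v_Lip f] unfolding w_def
        by eventually_elim (simp add: algebra_simps)
      \<comment> \<open>The right integrand is \<open>v x * (b f x * g x)\<close> by the Leibniz
        rule. It equals the left one on \<open>K\<close> and is nonnegative elsewhere, because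
        \<open>v \<ge> 0\<close> and \<open>g\<close> carries the sign of
        \<open>b f\<close>.\<close>
      have "(\<integral>x. 1 / D * (indicator K x * \<bar>b f x\<bar>) \<partial>m) \<le> (\<integral>x. b w x * g x - b v x * (f x * g x) \<partial>m)"
      proof (rule integral_mono_AE)
        show "integrable m (\<lambda>x. b w x * g x - b v x * (f x * g x))"
          using int_w int_v by (rule Bochner_Integration.integrable_diff)
        have "integrable m (\<lambda>x. indicator K x * \<bar>b f x\<bar>)"
          by (rule Bochner_Integration.integrable_bound[OF int_f])
            (use K(2) in \<open>auto simp: g_def A_def indicator_def abs_mult sgn_if subset_iff\<close>)
        then show "integrable m (\<lambda>x. 1 / D * (indicator K x * \<bar>b f x\<bar>))" by simp
        show "AE x in m. 1 / D * (indicator K x * \<bar>b f x\<bar>) \<le> b w x * g x - b v x * (f x * g x)"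
          using leib AE_space
        proof eventually_elim
          case (elim x)
          then have x: "x \<in> topspace \<tau>" by (simp add: space_m)
          have "0 \<le> b f x * g x" by (auto simp: g_def indicator_def sgn_if)
          moreover have "b f x * g x = \<bar>b f x\<bar>" "v x = 1 / D" if "x \<in> K"
            using that K(2) x u(4) by (auto simp: g_def A_def indicator_def sgn_if v_def)
          ultimately show ?case
            unfolding elim(1) using v_bound(1)[OF x] by (cases "x \<in> K") auto
        qed
      qed
      also have "\<dots> = (\<integral>x. b w x * g x \<partial>m) - (\<integral>x. b v x * (f x * g x) \<partial>m)"
        using int_w int_v by (rule Bochner_Integration.integral_diff)
      also have "\<dots> \<le> 2 / Suc n"
      proof -
        have "\<bar>\<integral>x. b w x * g x \<partial>m\<bar> < 1 / Suc n"
          by (rule F_small(1)[OF w_ball]) (rule v0(2))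
        moreover have "\<bar>\<integral>x. b v x * (f x * g x) \<partial>m\<bar> < 1 / Suc n"
          by (rule F_small(2)[OF v_ball]) (rule v0(1))
        moreover have "2 / Suc n = 1 / Suc n + 1 / Suc n" by simp
        ultimately show ?thesis by linarith
      qed
      finally show ?thesis using D(1) by (simp add: field_simps)
    qed
    have int: "integrable m (\<lambda>x. indicator K x * \<bar>b f x\<bar>)"
    proof -
      have "integrable m (indicat_real K)"
        by (rule integrable_const_bound[of _ 1]) (auto simp: indicator_def)
      then have "integrable m (\<lambda>x. \<bar>b f x\<bar> * indicator K x)"
        by (rule L_infinity_integrable[rotated]) (use Linf[OF f] in \<open>auto simp: L_infinity_def\<close>)
      then show ?thesis by (simp add: mult.commute)
    qed
    have "(\<lambda>n. 2 * D / Suc n) \<longlonglongrightarrow> 0"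
      using LIMSEQ_Suc[OF lim_const_over_n[of "2 * D"]] by simp
    from LIMSEQ_le_const[OF this] bound have "(\<integral>x. indicator K x * \<bar>b f x\<bar> \<partial>m) \<le> 0" by blast
    then have "(\<integral>x. indicator K x * \<bar>b f x\<bar> \<partial>m) = 0"
      by (intro order_antisym integral_nonneg_AE) auto
    then have "AE x in m. indicator K x * \<bar>b f x\<bar> = 0"
      by (subst (asm) integral_nonneg_eq_0_iff_AE[OF int]) auto
    then show ?thesis by eventually_elim (auto simp: indicator_def)
  qed
  have on_A: "AE x in m. x \<in> A k \<longrightarrow> b f x = 0" for k
  proof -
    have sets: "{x \<in> A k. b f x \<noteq> 0} \<in> sets m"
    proof -
      have "{x \<in> A k. b f x \<noteq> 0} = A k \<inter> {x \<in> space m. b f x \<noteq> 0}" by (auto simp: A_def space_m)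
      also have "\<dots> \<in> sets m" by measurable
      finally show ?thesis .
    qed
    moreover have "emeasure m {x \<in> A k. b f x \<noteq> 0} = 0"
    proof (rule null_if_compacts_null[OF sets])
      fix K assume K: "compactin \<tau> K" "K \<subseteq> {x \<in> A k. b f x \<noteq> 0}"
      then have "K \<subseteq> A k" by blast
      from on_compact[OF K(1) this] have "AE x in m. x \<notin> K"
        by eventually_elim (use K(2) in blast)
      then show "emeasure m K = 0"
        using compactin_sets[OF K(1)] by (simp add: AE_iff_null_sets null_setsD1)
    qed
    ultimately show ?thesis by (intro AE_I'[of "{x \<in> A k. b f x \<noteq> 0}"]) (auto simp: null_sets_def)
  qed
  \<comment> \<open>Points of \<open>C\<close> may lie in \<open>S\<close> and hence outside
    \<open>E\<close>, so density has to be transferred to a countable subset of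
    \<open>E\<close>.\<close>
  define E where "E = (topspace \<tau> - S) - (\<Union>k. A k)"
  have "d_separable d E"
  proof (rule d_separable_of_countable_dense[OF ext_distance C])
    show "\<exists>c\<in>C. d x c \<le> ennreal (1 / Suc n)" if "x \<in> E" for x n
      using that by (auto simp: E_def A_def not_less)
  qed (auto simp: E_def)
  moreover have "E \<in> sets m" unfolding E_def by measurable
  ultimately have "emeasure m E = 0"
    using S by (auto simp: maximal_separable_component_def E_def space_m)
  then have "AE x in m. x \<notin> E"
    using \<open>E \<in> sets m\<close> by (intro AE_not_in null_setsI)
  moreover have "AE x in m. \<forall>k. x \<in> A k \<longrightarrow> b f x = 0"
    unfolding AE_all_countable using on_A by blast
  ultimately show ?thesis
    by eventually_elim (auto simp: E_def)
qed

end

subsection \<open>Locality and boundedness of sequentially continuous derivations\<close>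

lemma lip_on_comp:
  assumes "lip_on d L A f" "\<And>s t. \<bar>\<theta> s - \<theta> t\<bar> \<le> c * \<bar>s - t\<bar>" "0 \<le> c"
  shows "lip_on d (c * L) A (\<lambda>x. \<theta> (f x))"
  unfolding lip_on_def
proof (intro ballI impI)
  fix x y assume xy: "x \<in> A" "y \<in> A" "d x y < \<infinity>"
  have "\<bar>\<theta> (f x) - \<theta> (f y)\<bar> \<le> c * \<bar>f x - f y\<bar>" by (rule assms(2))
  also have "\<dots> \<le> c * (L * enn2real (d x y))"
    using lip_onD[OF assms(1) xy] assms(3) by (rule mult_left_mono)
  finally show "\<bar>\<theta> (f x) - \<theta> (f y)\<bar> \<le> c * L * enn2real (d x y)" by (simp add: mult.assoc)
qed

text \<open>\<open>|g|\<close> splits into \<open>min |g| N\<close> and a remainder whose integral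
  is below \<open>\<eta> / 2\<close>; the bounded part contributes at most \<open>N\<close> times
  the measure. Finiteness of \<open>emeasure\<close> is required since \<open>measure\<close> is 0
  on sets of infinite measure.\<close>

lemma integral_absolutely_continuous:
  fixes g :: "'a \<Rightarrow> real"
  assumes g: "integrable m g" and \<eta>: "0 < \<eta>"
  shows "\<exists>\<delta>>0. \<forall>A\<in>sets m. emeasure m A < \<infinity> \<longrightarrow> measure m A < \<delta> \<longrightarrow>
    (\<integral>x. indicator A x * \<bar>g x\<bar> \<partial>m) < \<eta>"
proof -
  have [measurable]: "g \<in> borel_measurable m" using g by simp
  let ?r = "\<lambda>n x. \<bar>g x\<bar> - min \<bar>g x\<bar> (real n)"
  have "(\<lambda>n. \<integral>x. ?r n x \<partial>m) \<longlonglongrightarrow> (\<integral>x. 0 \<partial>m)"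
  proof (rule integral_dominated_convergence[where w = "\<lambda>x. \<bar>g x\<bar>"])
    show "AE x in m. (\<lambda>n. ?r n x) \<longlonglongrightarrow> 0"
    proof (rule AE_I2)
      fix x
      obtain N where N: "\<bar>g x\<bar> \<le> real N" using real_arch_simple by blast
      have "\<forall>\<^sub>F n in sequentially. ?r n x = 0"
        unfolding eventually_sequentially using N by (intro exI[of _ N]) auto
      then show "(\<lambda>n. ?r n x) \<longlonglongrightarrow> 0" by (rule tendsto_eventually)
    qed
    show "AE x in m. norm (?r n x) \<le> \<bar>g x\<bar>" for n by (rule AE_I2) auto
  qed (use g in simp_all)
  then have "\<forall>\<^sub>F n in sequentially. (\<integral>x. ?r n x \<partial>m) < \<eta> / 2"
    using \<eta> by (intro order_tendstoD(2)[of _ 0]) auto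
  then obtain N where N: "(\<integral>x. ?r N x \<partial>m) < \<eta> / 2"
    by (auto simp: eventually_sequentially)
  have int_r: "integrable m (?r N)"
    by (rule Bochner_Integration.integrable_bound[of m "\<lambda>x. \<bar>g x\<bar>"]) (use g in auto)
  \<comment> \<open>\<open>N + 1\<close> instead of \<open>N\<close> keeps the denominator positive
    when \<open>N = 0\<close>.\<close>
  define \<delta> where "\<delta> = \<eta> / (2 * (real N + 1))"
  have "(\<integral>x. indicator A x * \<bar>g x\<bar> \<partial>m) < \<eta>"
    if A [measurable]: "A \<in> sets m" and fin: "emeasure m A < \<infinity>" and small: "measure m A < \<delta>" for A
  proof -
    have int_A: "integrable m (\<lambda>x. real N * indicator A x)"
      using fin A by (simp add: integrable_real_indicator)
    have "(\<integral>x. indicator A x * \<bar>g x\<bar> \<partial>m) \<le> (\<integral>x. real N * indicator A x + ?r N x \<partial>m)"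
    proof (rule integral_mono_AE)
      show "integrable m (\<lambda>x. indicator A x * \<bar>g x\<bar>)"
        by (rule Bochner_Integration.integrable_bound[OF g]) (auto simp: indicator_def)
      show "integrable m (\<lambda>x. real N * indicator A x + ?r N x)"
        using int_A int_r by (rule Bochner_Integration.integrable_add)
    qed (auto simp: indicator_def)
    also have "\<dots> = real N * measure m A + (\<integral>x. ?r N x \<partial>m)"
      using Bochner_Integration.integral_add[OF int_A int_r] by simp
    also have "real N * measure m A \<le> \<eta> / 2"
    proof -
      have "real N * measure m A \<le> (real N + 1) * \<delta>"
        using small by (intro mult_mono) auto
      also have "\<dots> = \<eta> / 2" by (simp add: \<delta>_def divide_simps)
      finally show ?thesis .
    qed
    finally show ?thesis using N by linarith
  qed
  moreover have "0 < \<delta>" using \<eta> by (simp add: \<delta>_def)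
  ultimately show ?thesis by blast
qed

context emtm
begin

text \<open>Testing with the sign of \<open>h\<close> on \<open>A = {C < |h|}\<close> shows that the
  integral of \<open>|h| - C\<close> over \<open>A\<close> is at most 0. The integrand is positive
  there, so \<open>A\<close> is null. This makes the sets of the Baire argument closed.\<close>

lemma weak_star_limit_bound:
  assumes h: "h \<in> L_infinity m" "\<And>n. \<sigma> n \<in> L_infinity m"
    and lim: "\<And>g. integrable m g \<Longrightarrow> (\<lambda>n. \<integral>x. \<sigma> n x * g x \<partial>m) \<longlonglongrightarrow> (\<integral>x. h x * g x \<partial>m)"
    and bound: "\<And>n. AE x in m. \<bar>\<sigma> n x\<bar> \<le> C"
  shows "AE x in m. \<bar>h x\<bar> \<le> C"
proof -
  have [measurable]: "h \<in> borel_measurable m" "\<And>n. \<sigma> n \<in> borel_measurable m"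
    using h by (auto simp: L_infinity_def)
  define A where "A = {x \<in> space m. C < \<bar>h x\<bar>}"
  have [measurable]: "A \<in> sets m" unfolding A_def by measurable
  have ind: "integrable m (indicat_real A)"
    by (rule integrable_const_bound[of _ 1]) (auto simp: indicator_def)
  define g where "g x = indicator A x * sgn (h x)" for x
  have g: "integrable m g"
    unfolding g_def by (rule integrable_const_bound[of _ 1]) (auto simp: indicator_def sgn_if)
  have int_h: "integrable m (\<lambda>x. h x * g x)"
    by (rule L_infinity_integrable[OF h(1) g])
  have "(\<integral>x. \<sigma> n x * g x \<partial>m) \<le> (\<integral>x. C * indicator A x \<partial>m)" for n
  proof (rule integral_mono_AE)
    show "integrable m (\<lambda>x. \<sigma> n x * g x)" by (rule L_infinity_integrable[OF h(2) g])
    show "integrable m (\<lambda>x. C * indicator A x)" using ind by simp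
    show "AE x in m. \<sigma> n x * g x \<le> C * indicator A x"
      using bound[of n] by eventually_elim (auto simp: g_def indicator_def sgn_if)
  qed
  then have "(\<integral>x. h x * g x \<partial>m) \<le> (\<integral>x. C * indicator A x \<partial>m)"
    by (intro LIMSEQ_le_const2[OF lim[OF g]]) auto
  then have le: "(\<integral>x. h x * g x - C * indicator A x \<partial>m) \<le> 0"
    using int_h ind by simp
  have nonneg: "AE x in m. 0 \<le> h x * g x - C * indicator A x"
    by (rule AE_I2) (auto simp: g_def A_def indicator_def sgn_if)
  have int: "integrable m (\<lambda>x. h x * g x - C * indicator A x)"
    using int_h ind by simp
  have "(\<integral>x. h x * g x - C * indicator A x \<partial>m) = 0"
    using le integral_nonneg_AE[OF nonneg] by linarith
  then have "AE x in m. h x * g x - C * indicator A x = 0"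
    using integral_nonneg_eq_0_iff_AE[OF int nonneg] by blast
  then show ?thesis
    using AE_space by eventually_elim (auto simp: g_def A_def indicator_def sgn_if split: if_splits)
qed

text \<open>The hypothesis speaks only of the unit ball. One factor \<open>1 / (L + M)\<close>,
  common to the sequence and its limit, moves everything into it and is pulled out of
  \<open>b\<close> by linearity.\<close>

lemma weak_star_seq_continuous_integral:
  assumes b: "lipschitz_derivation \<tau> d m b" "weak_star_seq_continuous \<tau> d m b"
    and h: "\<And>n. h n \<in> Lip_b \<tau> d" "\<And>n. lip_on d L (topspace \<tau>) (h n)"
      "\<And>n x. x \<in> topspace \<tau> \<Longrightarrow> \<bar>h n x\<bar> \<le> M"
    and f: "f \<in> Lip_b \<tau> d" "lip_on d L (topspace \<tau>) f" "\<And>x. x \<in> topspace \<tau> \<Longrightarrow> \<bar>f x\<bar> \<le> M"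
    and LM: "0 < L" "0 < M" and lim: "\<And>x. x \<in> topspace \<tau> \<Longrightarrow> (\<lambda>n. h n x) \<longlonglongrightarrow> f x"
    and g: "integrable m g"
  shows "(\<lambda>n. \<integral>x. b (h n) x * g x \<partial>m) \<longlonglongrightarrow> (\<integral>x. b f x * g x \<partial>m)"
proof -
  define c where "c = 1 / (L + M)"
  have c: "0 < c" "c * L + c * M \<le> 1" using LM by (simp_all add: c_def add_divide_distrib[symmetric])
  define s where "s \<phi> = (\<lambda>x\<in>topspace \<tau>. c * \<phi> x)" for \<phi> :: "'a \<Rightarrow> real"
  have Linf: "b \<phi> \<in> L_infinity m" if "\<phi> \<in> Lip_b \<tau> d" for \<phi>
    using b(2) that by (simp add: weak_star_seq_continuous_def)
  have s_Lip: "s \<phi> \<in> Lip_b \<tau> d" if "\<phi> \<in> Lip_b \<tau> d" for \<phi>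
    using Lip_b_lincomb[OF ext_distance that that, of c 0] by (simp add: s_def)
  have s_ball: "s \<phi> \<in> Lip_b_ball \<tau> d"
    if \<phi>: "\<phi> \<in> Lip_b \<tau> d" "lip_on d L (topspace \<tau>) \<phi>" "\<And>x. x \<in> topspace \<tau> \<Longrightarrow> \<bar>\<phi> x\<bar> \<le> M" for \<phi>
  proof (rule Lip_b_ballI[OF ext_distance s_Lip[OF \<phi>(1)]])
    show "lip_on d (c * L) (topspace \<tau>) (s \<phi>)"
      using lip_on_cmult[OF \<phi>(2), of c] c lip_on_cong[of "topspace \<tau>" "s \<phi>" "\<lambda>x. c * \<phi> x" d]
      by (simp add: s_def)
    show "\<bar>s \<phi> x\<bar> \<le> c * M" if "x \<in> topspace \<tau>" for x
      using mult_left_mono[OF \<phi>(3)[OF that], of c] c that by (simp add: s_def abs_mult)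
  qed (use c LM in simp_all)
  have s_int: "(\<integral>x. b (s \<phi>) x * g x \<partial>m) = c * (\<integral>x. b \<phi> x * g x \<partial>m)" if \<phi>: "\<phi> \<in> Lip_b \<tau> d" for \<phi>
  proof -
    have [measurable]: "b \<phi> \<in> borel_measurable m" "b (s \<phi>) \<in> borel_measurable m" "g \<in> borel_measurable m"
      using Linf[OF \<phi>] Linf[OF s_Lip[OF \<phi>]] g by (auto simp: L_infinity_def)
    have "(\<integral>x. b (s \<phi>) x * g x \<partial>m) = (\<integral>x. c * (b \<phi> x * g x) \<partial>m)"
    proof (rule integral_cong_AE)
      show "AE x in m. b (s \<phi>) x * g x = c * (b \<phi> x * g x)"
        using derivation_cmult[OF b(1) \<phi>, of c] unfolding s_def by eventually_elim simp
    qed measurable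
    then show ?thesis by simp
  qed
  have "limitin (ball_pointwise_topology \<tau> d) (\<lambda>n. s (h n)) (s f) sequentially"
    unfolding limitin_ball_pointwise_iff
  proof (intro conjI ballI always_eventually allI)
    show "(\<lambda>n. s (h n) x) \<longlonglongrightarrow> s f x" if "x \<in> topspace \<tau>" for x
      using tendsto_mult_left[OF lim[OF that], of c] that by (simp add: s_def)
  qed (use s_ball h f in blast)+
  moreover have "range (\<lambda>n. s (h n)) \<subseteq> Lip_b_ball \<tau> d" using s_ball h by blast
  ultimately have "limitin (weak_star_topology m) (b \<circ> (\<lambda>n. s (h n))) (b (s f)) sequentially"
    using b(2) unfolding weak_star_seq_continuous_def by blast
  then have "(\<lambda>n. \<integral>x. b (s (h n)) x * g x \<partial>m) \<longlonglongrightarrow> (\<integral>x. b (s f) x * g x \<partial>m)"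
    using g by (simp add: limitin_weak_star_iff)
  then have "(\<lambda>n. c * (\<integral>x. b (h n) x * g x \<partial>m)) \<longlonglongrightarrow> c * (\<integral>x. b f x * g x \<partial>m)"
    by (simp only: s_int[OF h(1)] s_int[OF f(1)])
  then show ?thesis
    using c(1) by (simp add: tendsto_mult_left_iff)
qed

text \<open>Soft thresholding \<open>f\<close> at height \<open>e\<close> gives \<open>h\<close> with \<open>h = h \<kappa>\<close>, where \<open>\<kappa>\<close> is a Lipschitz
  function of \<open>f\<close> and both factors vanish on \<open>{f = 0}\<close>; the Leibniz rule then kills \<open>b h\<close> there.\<close>

lemma weak_star_seq_continuous_imp_local:
  assumes b: "lipschitz_derivation \<tau> d m b" "weak_star_seq_continuous \<tau> d m b"
  shows "local_derivation \<tau> d m b"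
  unfolding local_derivation_def
proof (intro conjI ballI b)
  fix f assume f: "f \<in> Lip_b \<tau> d"
  obtain L M where LM: "0 < L" "0 < M" "lip_on d L (topspace \<tau>) f" "\<And>x. x \<in> topspace \<tau> \<Longrightarrow> \<bar>f x\<bar> \<le> M"
    and cont_f: "continuous_map \<tau> euclideanreal f"
    using Lip_bE[OF ext_distance f] by metis
  have Linf: "b \<phi> \<in> L_infinity m" if "\<phi> \<in> Lip_b \<tau> d" for \<phi>
    using b(2) that by (simp add: weak_star_seq_continuous_def)
  define e where "e n = 1 / real (Suc n)" for n
  have e: "0 < e n" for n by (simp add: e_def)
  define \<theta> where "\<theta> n t = max (t - e n) 0 + min (t + e n) 0" for n t
  \<comment> \<open>\<open>\<rho> n\<close> is 1 where \<open>\<theta> n\<close> is nonzero. Its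
    Lipschitz constant \<open>1 / e n\<close> grows with \<open>n\<close>, but the product is used
    for one \<open>n\<close> at a time; only the functions \<open>h n\<close> need common
    bounds.\<close>
  define \<rho> where "\<rho> n t = min 1 (1 / e n * \<bar>t\<bar>)" for n t
  define h where "h n = (\<lambda>x\<in>topspace \<tau>. \<theta> n (f x))" for n
  define \<kappa> where "\<kappa> n = (\<lambda>x\<in>topspace \<tau>. \<rho> n (f x))" for n
  have \<theta>: "\<bar>\<theta> n s - \<theta> n t\<bar> \<le> 1 * \<bar>s - t\<bar>" "\<bar>\<theta> n t\<bar> \<le> \<bar>t\<bar>" "\<bar>\<theta> n t - t\<bar> \<le> e n" "\<theta> n 0 = 0" for n s t
    using e[of n] by (auto simp: \<theta>_def abs_if max_def min_def)
  have \<rho>: "\<bar>\<rho> n s - \<rho> n t\<bar> \<le> 1 / e n * \<bar>s - t\<bar>" "\<bar>\<rho> n t\<bar> \<le> 1" "\<rho> n 0 = 0" for n s t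
  proof -
    have "\<bar>1 / e n * \<bar>s\<bar> - 1 / e n * \<bar>t\<bar>\<bar> = 1 / e n * \<bar>\<bar>s\<bar> - \<bar>t\<bar>\<bar>"
      unfolding right_diff_distrib[symmetric] abs_mult using e[of n] by simp
    also have "\<dots> \<le> 1 / e n * \<bar>s - t\<bar>"
      using e[of n] by (intro mult_left_mono) auto
    finally show "\<bar>\<rho> n s - \<rho> n t\<bar> \<le> 1 / e n * \<bar>s - t\<bar>"
      unfolding \<rho>_def by (rule order_trans[rotated]) (simp add: min_def abs_if)
    show "\<bar>\<rho> n t\<bar> \<le> 1" "\<rho> n 0 = 0"
      using e[of n] by (auto simp: \<rho>_def min_def)
  qed
  have \<theta>\<rho>: "\<theta> n t * \<rho> n t = \<theta> n t" for n t
  proof (cases "\<bar>t\<bar> \<le> e n")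
    case True
    then have "\<theta> n t = 0" by (auto simp: \<theta>_def abs_le_iff)
    then show ?thesis by simp
  next
    case False
    then have "\<rho> n t = 1" using e[of n] by (simp add: \<rho>_def min_def pos_divide_le_eq)
    then show ?thesis by simp
  qed
  have lip_h: "lip_on d L (topspace \<tau>) (\<lambda>x. \<theta> n (f x))" for n
    using lip_on_comp[OF LM(3) \<theta>(1), of n] by simp
  have h_Lip: "h n \<in> Lip_b \<tau> d" for n
    unfolding h_def
  proof (rule Lip_bI[OF ext_distance _ _ _ lip_h])
    show "continuous_map \<tau> euclideanreal (\<lambda>x. \<theta> n (f x))"
      unfolding \<theta>_def using cont_f
      by (intro continuous_map_add continuous_map_real_max continuous_map_real_min continuous_map_diff) auto
    show "\<bar>\<theta> n (f x)\<bar> \<le> M" if "x \<in> topspace \<tau>" for x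
      using \<theta>(2)[of n "f x"] LM(4)[OF that] by linarith
  qed (use LM in simp)
  have \<kappa>_Lip: "\<kappa> n \<in> Lip_b \<tau> d" for n
    unfolding \<kappa>_def
  proof (rule Lip_bI[OF ext_distance _ _ _ lip_on_comp[OF LM(3) \<rho>(1)]])
    show "continuous_map \<tau> euclideanreal (\<lambda>x. \<rho> n (f x))"
      unfolding \<rho>_def using cont_f
      by (intro continuous_map_real_min continuous_map_real_mult continuous_map_real_abs) auto
  qed (use LM e[of n] \<rho>(2) in auto)
  have h_mult: "(\<lambda>x\<in>topspace \<tau>. h n x * \<kappa> n x) = h n" for n
    by (auto simp: h_def \<kappa>_def \<theta>\<rho> fun_eq_iff)
  have vanish: "AE x in m. f x = 0 \<longrightarrow> b (h n) x = 0" for n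
    using derivation_mult[OF b(1) h_Lip \<kappa>_Lip, of n n] AE_space unfolding h_mult
  proof eventually_elim
    case (elim x)
    then show ?case by (auto simp: space_m h_def \<kappa>_def \<theta>(4) \<rho>(3))
  qed
  have [measurable]: "f \<in> borel_measurable m" "\<And>n. b (h n) \<in> borel_measurable m" "b f \<in> borel_measurable m"
    using Linf[OF f] Linf[OF h_Lip] Lip_b_measurable[OF f] by (auto simp: L_infinity_def)
  \<comment> \<open>With this test function the integrals of \<open>b (h n)\<close> are 0, while
    that of \<open>b f\<close> is the integral of \<open>|b f|\<close> over
    \<open>{f = 0}\<close>.\<close>
  define g where "g x = (if f x = 0 then sgn (b f x) else 0)" for x
  have [measurable]: "g \<in> borel_measurable m" unfolding g_def by measurable
  have g: "integrable m g"
    by (rule integrable_const_bound[of _ 1]) (auto simp: g_def sgn_if)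
  have "(\<integral>x. b (h n) x * g x \<partial>m) = 0" for n
    using vanish[of n] by (intro integral_eq_zero_AE) (auto simp: g_def elim: eventually_mono)
  moreover have "(\<lambda>n. \<integral>x. b (h n) x * g x \<partial>m) \<longlonglongrightarrow> (\<integral>x. b f x * g x \<partial>m)"
  proof (rule weak_star_seq_continuous_integral[OF b h_Lip _ _ f LM(3,4,1,2) _ g])
    show "lip_on d L (topspace \<tau>) (h n)" for n
      using lip_h[of n] lip_on_cong[of "topspace \<tau>" "h n" "\<lambda>x. \<theta> n (f x)" d L] by (simp add: h_def)
    show "\<bar>h n x\<bar> \<le> M" if "x \<in> topspace \<tau>" for n x
      using \<theta>(2)[of n "f x"] LM(4)[OF that] that by (simp add: h_def)
    show "(\<lambda>n. h n x) \<longlonglongrightarrow> f x" if "x \<in> topspace \<tau>" for x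
    proof (rule LIM_zero_cancel, rule Lim_null_comparison)
      show "\<forall>\<^sub>F n in sequentially. norm (h n x - f x) \<le> e n"
        using \<theta>(3) that by (intro always_eventually) (simp add: h_def)
      show "e \<longlonglongrightarrow> 0" unfolding e_def by (rule LIMSEQ_Suc[OF lim_1_over_n])
    qed
  qed
  ultimately have "(\<integral>x. b f x * g x \<partial>m) = 0"
    by (simp add: LIMSEQ_const_iff)
  moreover have "AE x in m. 0 \<le> b f x * g x"
    by (rule AE_I2) (auto simp: g_def sgn_if)
  ultimately have "AE x in m. b f x * g x = 0"
    using integral_nonneg_eq_0_iff_AE[OF L_infinity_integrable[OF Linf[OF f] g]] by blast
  then show "AE x in m. f x = 0 \<longrightarrow> b f x = 0"
    by eventually_elim (auto simp: g_def sgn_if split: if_splits)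
qed

text \<open>Locality applied to \<open>F - G\<close>. It is the reason why the restricted derivation
  does not depend on the chosen extensions.\<close>

lemma local_derivation_cong:
  assumes b: "local_derivation \<tau> d m b" and "F \<in> Lip_b \<tau> d" "G \<in> Lip_b \<tau> d"
    and eq: "\<And>x. x \<in> A \<Longrightarrow> F x = G x"
  shows "AE x in m. x \<in> A \<longrightarrow> b F x = b G x"
proof -
  have der: "lipschitz_derivation \<tau> d m b" using b by (simp add: local_derivation_def)
  have "(\<lambda>x\<in>topspace \<tau>. F x - G x) \<in> Lip_b \<tau> d"
    using Lip_b_lincomb[OF ext_distance assms(2,3), of 1 "-1"] by simp
  then have "AE x in m. (\<lambda>x\<in>topspace \<tau>. F x - G x) x = 0 \<longrightarrow> b (\<lambda>x\<in>topspace \<tau>. F x - G x) x = 0"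
    using b unfolding local_derivation_def by blast
  with derivation_diff[OF der assms(2,3)] AE_space show ?thesis
  proof eventually_elim
    case (elim x)
    then show ?case using eq[of x] by (simp add: space_m)
  qed
qed

end

text \<open>Baire needs a complete metric, while continuity of a derivation is stated for pointwise
  convergence. Closedness in the uniform metric requires only that uniform limits are pointwise
  ones.\<close>

lemma tendsto_of_limitin_cfunspace:
  assumes "limitin (mtopology_of (cfunspace \<tau> (euclidean_metric :: real metric))) \<sigma> l sequentially"
    and x: "x \<in> topspace \<tau>"
  shows "(\<lambda>n. \<sigma> n x) \<longlonglongrightarrow> l x"
proof (rule metric_LIMSEQ_I)
  let ?C = "cfunspace \<tau> (euclidean_metric :: real metric)"
  interpret C: Metric_space "mspace ?C" "mdist ?C" by (rule Metric_space_mspace_mdist)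
  fix \<epsilon> :: real assume "0 < \<epsilon>"
  then obtain N where l: "l \<in> mspace ?C" and N: "\<And>n. N \<le> n \<Longrightarrow> \<sigma> n \<in> mspace ?C \<and> mdist ?C (\<sigma> n) l < \<epsilon>"
    using assms(1) unfolding mtopology_of_def C.limit_metric_sequentially by blast
  have "dist (\<sigma> n x) (l x) < \<epsilon>" if "N \<le> n" for n
  proof -
    have "mdist euclidean_metric (\<sigma> n x) (l x) \<le> mdist ?C (\<sigma> n) l"
      using N[OF that] by (intro mdist_cfunspace_imp_mdist_le[OF _ l order_refl x]) simp
    then show ?thesis using N[OF that] by simp
  qed
  then show "\<exists>N. \<forall>n\<ge>N. dist (\<sigma> n x) (l x) < \<epsilon>" by blast
qed

context emtm
begin

text \<open>Baire category on the uniformly closed set \<open>D\<close>: it is the union of the closed sets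
  \<open>{f. \<bar>b f\<bar> \<le> k}\<close>, and convexity moves a ball contained in one of them to the whole of \<open>D\<close>.\<close>

lemma weak_star_seq_continuous_bounded_aux:
  assumes b: "lipschitz_derivation \<tau> d m b" "weak_star_seq_continuous \<tau> d m b"
  shows "\<exists>C. \<forall>f\<in>Lip_b \<tau> d. lip_on d (1/2) (topspace \<tau>) f \<longrightarrow> (\<forall>x\<in>topspace \<tau>. \<bar>f x\<bar> \<le> 1/2) \<longrightarrow>
    (AE x in m. \<bar>b f x\<bar> \<le> C)"
proof -
  let ?C = "cfunspace \<tau> (euclidean_metric :: real metric)"
  \<comment> \<open>The budget 1 of the unit ball is divided evenly between Lipschitz constant and
    supremum. Each bound passes separately to limits and convex combinations.\<close>
  define D where "D = {f \<in> Lip_b \<tau> d. lip_on d (1/2) (topspace \<tau>) f \<and> (\<forall>x\<in>topspace \<tau>. \<bar>f x\<bar> \<le> 1/2)}"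
  interpret C: Metric_space "mspace ?C" "mdist ?C" by (rule Metric_space_mspace_mdist)
  have D_sub: "D \<subseteq> mspace ?C"
    by (auto simp: D_def Lip_b_def)
  have D_closed: "closedin C.mtopology D"
    unfolding C.metric_closedin_iff_sequentially_closed
  proof (intro conjI D_sub allI impI)
    fix \<sigma> l assume \<sigma>: "range \<sigma> \<subseteq> D \<and> limitin C.mtopology \<sigma> l sequentially"
    have lim: "(\<lambda>n. \<sigma> n x) \<longlonglongrightarrow> l x" if "x \<in> topspace \<tau>" for x
      using tendsto_of_limitin_cfunspace[OF _ that] \<sigma> by (simp add: mtopology_of_def)
    have \<sigma>D: "\<sigma> n \<in> D" for n using \<sigma> by blast
    have "l \<in> mspace ?C" using \<sigma> C.limitin_mspace by blast
    then have l: "l \<in> extensional (topspace \<tau>)" "continuous_map \<tau> euclideanreal l" by simp_all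
    have lip: "lip_on d (1/2) (topspace \<tau>) l"
      by (rule lip_on_limit[OF _ lim]) (use \<sigma>D in \<open>auto simp: D_def\<close>)
    have bd: "\<bar>l x\<bar> \<le> 1/2" if "x \<in> topspace \<tau>" for x
      by (rule LIMSEQ_le_const2[OF tendsto_rabs[OF lim[OF that]]]) (use \<sigma>D that in \<open>auto simp: D_def\<close>)
    have "restrict l (topspace \<tau>) \<in> Lip_b \<tau> d"
      by (rule Lip_bI[OF ext_distance l(2) bd _ lip]) simp_all
    then show "l \<in> D" using l(1) lip bd by (simp add: D_def extensional_restrict)
  qed
  interpret D: Submetric "mspace ?C" "mdist ?C" D by unfold_locales (rule D_sub)
  have "C.mcomplete"
    using Met_TC.mcomplete_cfunspace[where ?'a = real, of \<tau>]
    by (simp add: mcomplete_of_def Met_TC.Self_def euclidean_metric_def[symmetric] complete_UNIV)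
  then have complete: "D.sub.mcomplete"
    using D.closedin_eq_mcomplete D_closed by blast
  have Linf: "b \<phi> \<in> L_infinity m" if "\<phi> \<in> Lip_b \<tau> d" for \<phi>
    using b(2) that by (simp add: weak_star_seq_continuous_def)
  define A where "A k = {f \<in> D. AE x in m. \<bar>b f x\<bar> \<le> real k}" for k :: nat
  have A_closed: "closedin D.sub.mtopology (A k)" for k
    unfolding D.sub.metric_closedin_iff_sequentially_closed
  proof (intro conjI allI impI)
    show "A k \<subseteq> D" by (auto simp: A_def)
    fix \<sigma> l assume \<sigma>: "range \<sigma> \<subseteq> A k \<and> limitin D.sub.mtopology \<sigma> l sequentially"
    then have "limitin C.mtopology \<sigma> l sequentially" "l \<in> D"
      by (auto simp: D.mtopology_submetric limitin_subtopology)
    then have lim: "(\<lambda>n. \<sigma> n x) \<longlonglongrightarrow> l x" if "x \<in> topspace \<tau>" for x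
      using tendsto_of_limitin_cfunspace[OF _ that] by (simp add: mtopology_of_def)
    have \<sigma>A: "\<sigma> n \<in> A k" for n using \<sigma> by blast
    then have \<sigma>D: "\<sigma> n \<in> D" for n by (auto simp: A_def)
    have "AE x in m. \<bar>b l x\<bar> \<le> real k"
    proof (rule weak_star_limit_bound)
      show "b l \<in> L_infinity m" using \<open>l \<in> D\<close> by (intro Linf) (simp add: D_def)
      show "b (\<sigma> n) \<in> L_infinity m" for n using \<sigma>D[of n] by (intro Linf) (simp add: D_def)
      show "AE x in m. \<bar>b (\<sigma> n) x\<bar> \<le> real k" for n using \<sigma>A[of n] by (simp add: A_def)
      show "(\<lambda>n. \<integral>x. b (\<sigma> n) x * g x \<partial>m) \<longlonglongrightarrow> (\<integral>x. b l x * g x \<partial>m)" if "integrable m g" for g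
        by (rule weak_star_seq_continuous_integral[OF b, where L = "1/2" and M = "1/2"])
          (use \<sigma>D \<open>l \<in> D\<close> lim that in \<open>auto simp: D_def\<close>)
    qed
    then show "l \<in> A k" using \<open>l \<in> D\<close> by (simp add: A_def)
  qed
  have A_Un: "\<Union>(range A) = D"
  proof
    show "D \<subseteq> \<Union>(range A)"
    proof
      fix f assume f: "f \<in> D"
      then obtain c where c: "AE x in m. \<bar>b f x\<bar> \<le> c"
        using Linf[of f] by (auto simp: D_def L_infinity_def)
      obtain k where "c \<le> real k" using real_arch_simple by blast
      with c have "AE x in m. \<bar>b f x\<bar> \<le> real k" by (auto elim: eventually_mono)
      then show "f \<in> \<Union>(range A)" using f by (auto simp: A_def)
    qed
  qed (auto simp: A_def)
  have "(\<lambda>y\<in>topspace \<tau>. 0) \<in> D"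
    using Lip_b_ballD(1)[OF ext_distance zero_in_ball] by (simp add: D_def lip_on_def)
  then have "D.sub.mtopology interior_of \<Union>(range A) \<noteq> {}"
    unfolding A_Un using interior_of_topspace[of D.sub.mtopology] by auto
  then obtain k where "D.sub.mtopology interior_of (A k) \<noteq> {}"
    using D.sub.metric_Baire_category_alt[OF complete, of "range A"] A_closed by auto
  then obtain f0 \<epsilon> where f0: "f0 \<in> D" "0 < \<epsilon>" "D.sub.mball f0 \<epsilon> \<subseteq> A k"
    unfolding D.sub.metric_interior_of by auto
  \<comment> \<open>Below 1 for convexity, below \<open>\<epsilon>\<close> so that moving from
    \<open>f0\<close> by the fraction \<open>t\<close> towards any \<open>f\<close> stays in the
    ball; elements of \<open>D\<close> are at uniform distance at most 1.\<close>
  define t where "t = min (1/2) (\<epsilon>/2)"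
  have t: "0 < t" "t < 1" "t < \<epsilon>" using f0(2) by (auto simp: t_def)
  have "AE x in m. \<bar>b f x\<bar> \<le> 2 * real k / t" if f: "f \<in> D" for f
  proof -
    have fL: "f \<in> Lip_b \<tau> d" "f0 \<in> Lip_b \<tau> d" using f f0 by (auto simp: D_def)
    \<comment> \<open>Both \<open>f0\<close> and \<open>h\<close> lie in \<open>A k\<close>, so
      \<open>t * b f = b h - (1 - t) * b f0\<close> is bounded by \<open>2 * k\<close>.\<close>
    define h where "h = (\<lambda>x\<in>topspace \<tau>. (1 - t) * f0 x + t * f x)"
    have "h \<in> D"
      unfolding D_def
    proof (intro CollectI conjI ballI)
      show "h \<in> Lip_b \<tau> d" unfolding h_def by (rule Lip_b_lincomb[OF ext_distance fL(2,1)])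
      have "lip_on d (\<bar>1 - t\<bar> * (1/2) + \<bar>t\<bar> * (1/2)) (topspace \<tau>) (\<lambda>x. (1 - t) * f0 x + t * f x)"
        using f f0 by (intro lip_on_add lip_on_cmult) (auto simp: D_def)
      then show "lip_on d (1/2) (topspace \<tau>) h"
        using t lip_on_cong[of "topspace \<tau>" h "\<lambda>x. (1 - t) * f0 x + t * f x" d "1/2"] by (simp add: h_def field_simps)
      show "\<bar>h x\<bar> \<le> 1/2" if x: "x \<in> topspace \<tau>" for x
      proof -
        have "\<bar>(1 - t) * f0 x\<bar> \<le> (1 - t) * (1/2)" "\<bar>t * f x\<bar> \<le> t * (1/2)"
          unfolding abs_mult using t f f0 x by (auto intro!: mult_mono simp: D_def)
        then have "\<bar>(1 - t) * f0 x + t * f x\<bar> \<le> (1 - t) * (1/2) + t * (1/2)" by linarith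
        then show ?thesis using x by (simp add: h_def field_simps)
      qed
    qed
    moreover have "mdist ?C f0 h \<le> t"
    proof (rule mdist_cfunspace_le)
      fix x assume x: "x \<in> topspace \<tau>"
      have "f0 x - h x = t * (f0 x - f x)" using x by (simp add: h_def algebra_simps)
      moreover have "\<bar>f0 x\<bar> \<le> 1/2" "\<bar>f x\<bar> \<le> 1/2" using f f0 x by (auto simp: D_def)
      then have "t * \<bar>f0 x - f x\<bar> \<le> t * 1" using t(1) by (intro mult_left_mono) linarith+
      ultimately show "mdist euclidean_metric (f0 x) (h x) \<le> t"
        using t(1) by (simp add: dist_real_def abs_mult)
    qed (use t in simp)
    ultimately have "h \<in> D.sub.mball f0 \<epsilon>" using f0(1) t(3) by (simp add: D.sub.in_mball)
    then have "h \<in> A k" using f0(3) by blast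
    moreover have "f0 \<in> D.sub.mball f0 \<epsilon>" using f0 by simp
    then have "f0 \<in> A k" using f0(3) by blast
    ultimately have "AE x in m. \<bar>b h x\<bar> \<le> real k" "AE x in m. \<bar>b f0 x\<bar> \<le> real k"
      by (simp_all add: A_def)
    moreover have "AE x in m. b h x = (1 - t) * b f0 x + t * b f x"
      unfolding h_def by (rule derivation_lincomb[OF b(1) fL(2,1)])
    ultimately show ?thesis
    proof eventually_elim
      case (elim x)
      have "\<bar>(1 - t) * b f0 x\<bar> \<le> 1 * real k"
        unfolding abs_mult using t elim by (intro mult_mono) auto
      then have "\<bar>t * b f x\<bar> \<le> 2 * real k" using elim by linarith
      then show ?case using t(1) by (simp add: abs_mult pos_le_divide_eq mult.commute)
    qed
  qed
  then show ?thesis by (intro exI[of _ "2 * real k / t"]) (simp add: D_def)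
qed

text \<open>Homogeneity: scaling by \<open>1 / (2 * (L + M))\<close> reaches the set covered by the
  Baire argument, and the factor 2 returns in the constant.\<close>

lemma weak_star_seq_continuous_bounded:
  assumes b: "lipschitz_derivation \<tau> d m b" "weak_star_seq_continuous \<tau> d m b"
  obtains C where "0 \<le> C" "\<And>f L M. f \<in> Lip_b \<tau> d \<Longrightarrow> 0 < L \<Longrightarrow> 0 < M \<Longrightarrow> lip_on d L (topspace \<tau>) f \<Longrightarrow>
    (\<And>x. x \<in> topspace \<tau> \<Longrightarrow> \<bar>f x\<bar> \<le> M) \<Longrightarrow> AE x in m. \<bar>b f x\<bar> \<le> C * (L + M)"
proof -
  obtain C where C: "\<And>f. f \<in> Lip_b \<tau> d \<Longrightarrow> lip_on d (1/2) (topspace \<tau>) f \<Longrightarrow>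
    (\<forall>x\<in>topspace \<tau>. \<bar>f x\<bar> \<le> 1/2) \<Longrightarrow> AE x in m. \<bar>b f x\<bar> \<le> C"
    using weak_star_seq_continuous_bounded_aux[OF b] by blast
  show ?thesis
  proof (rule that[of "2 * \<bar>C\<bar>"])
    fix f L M assume f: "f \<in> Lip_b \<tau> d" "0 < L" "0 < M" "lip_on d L (topspace \<tau>) f"
      "\<And>x. x \<in> topspace \<tau> \<Longrightarrow> \<bar>f x\<bar> \<le> M"
    define c where "c = 1 / (2 * (L + M))"
    have c: "0 < c" "c * L \<le> 1/2" "c * M \<le> 1/2" "c * (L + M) = 1/2"
      using f(2,3) by (simp_all add: c_def field_simps)
    define h where "h = (\<lambda>x\<in>topspace \<tau>. c * f x)"
    have h_Lip: "h \<in> Lip_b \<tau> d"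
      using Lip_b_lincomb[OF ext_distance f(1) f(1), of c 0] by (simp add: h_def)
    have "lip_on d (c * L) (topspace \<tau>) (\<lambda>x. c * f x)"
      using lip_on_cmult[OF f(4), of c] c by simp
    then have "lip_on d (1/2) (topspace \<tau>) (\<lambda>x. c * f x)"
      using c(2) by (rule lip_on_weaken)
    then have "lip_on d (1/2) (topspace \<tau>) h"
      using lip_on_cong[of "topspace \<tau>" h "\<lambda>x. c * f x" d "1/2"] by (simp add: h_def)
    moreover have "\<bar>h x\<bar> \<le> 1/2" if "x \<in> topspace \<tau>" for x
    proof -
      have "c * \<bar>f x\<bar> \<le> c * M" using f(5)[OF that] c(1) by (intro mult_left_mono) auto
      also note c(3)
      finally show ?thesis using that c(1) by (simp add: h_def abs_mult)
    qed
    ultimately have "AE x in m. \<bar>b h x\<bar> \<le> C" using C[OF h_Lip] by blast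
    moreover have "AE x in m. b h x = c * b f x"
      unfolding h_def by (rule derivation_cmult[OF b(1) f(1)])
    ultimately show "AE x in m. \<bar>b f x\<bar> \<le> 2 * \<bar>C\<bar> * (L + M)"
    proof eventually_elim
      case (elim x)
      then have "c * \<bar>b f x\<bar> \<le> \<bar>C\<bar>" using c(1) by (simp add: abs_mult)
      also have "\<dots> = c * (L + M) * (2 * \<bar>C\<bar>)" unfolding c(4) by simp
      also have "\<dots> = c * (2 * \<bar>C\<bar> * (L + M))" by (simp only: ac_simps)
      finally show ?case using c(1) by simp
    qed
  qed simp
qed

section \<open>Inner approximation and exhaustion by compact sets\<close>

lemma ex_compact_approx:
  assumes A: "A \<in> sets m" and \<epsilon>: "0 < \<epsilon>"
  shows "\<exists>K. compactin \<tau> K \<and> K \<subseteq> A \<and> measure m (A - K) < \<epsilon>"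
\<comment> \<open>In the first case \<open>measure m A - \<epsilon>\<close> is negative and
  \<open>ennreal\<close> would truncate it to 0, so the empty set is taken instead.\<close>
proof (cases "measure m A < \<epsilon>")
  case True
  then show ?thesis by (intro exI[of _ "{}"]) simp
next
  case False
  have "ennreal (measure m A - \<epsilon>) < emeasure m A"
    using False \<epsilon> by (simp add: emeasure_eq_measure ennreal_less_iff)
  then obtain K where K: "compactin \<tau> K" "K \<subseteq> A" "ennreal (measure m A - \<epsilon>) < emeasure m K"
    unfolding emeasure_inner[OF A] less_SUP_iff by blast
  then have "measure m A - \<epsilon> < measure m K"
    using False by (simp add: emeasure_eq_measure ennreal_less_iff)
  then have "measure m (A - K) < \<epsilon>"
    using finite_measure_Diff[OF A compactin_sets[OF K(1)] K(2)] by simp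
  then show ?thesis using K by blast
qed

text \<open>Recursion on pairs: the newest compact set and the union of all so far. Each new set is
  chosen inside the part of \<open>E\<close> not yet covered, which gives disjointness, and leaves
  measure below \<open>1 / Suc n\<close> uncovered.\<close>

lemma ex_compact_exhaustion:
  assumes E: "E \<in> sets m"
  shows "\<exists>K. compact_exhaustion \<tau> m E K"
proof -
  \<comment> \<open>The clause for \<open>n = 0\<close> says that the initial union contains nothing
    but the first set; it starts the induction showing that the sets cover every union.\<close>
  let ?P = "\<lambda>n p. compactin \<tau> (fst p) \<and> compactin \<tau> (snd p) \<and> fst p \<subseteq> snd p \<and> snd p \<subseteq> E \<and>
    measure m (E - snd p) < 1 / real (Suc n) \<and> (n = 0 \<longrightarrow> snd p = fst p)"
  let ?Q = "\<lambda>(n::nat) p q. fst q \<inter> snd p = {} \<and> snd q = snd p \<union> fst q"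
  have "\<exists>p. \<forall>n. ?P n (p n) \<and> ?Q n (p n) (p (Suc n))"
  proof (rule dependent_nat_choice)
    obtain K where "compactin \<tau> K" "K \<subseteq> E" "measure m (E - K) < 1 / real (Suc 0)"
      using ex_compact_approx[OF E, of "1 / real (Suc 0)"] by auto
    then show "\<exists>p. ?P 0 p" by (intro exI[of _ "(K, K)"]) simp
  next
    fix p n assume p: "?P n p"
    then have "E - snd p \<in> sets m" using E compactin_sets by auto
    then obtain K where K: "compactin \<tau> K" "K \<subseteq> E - snd p" "measure m (E - snd p - K) < 1 / real (Suc (Suc n))"
      using ex_compact_approx[of "E - snd p" "1 / real (Suc (Suc n))"] by auto
    have eq: "E - (snd p \<union> K) = E - snd p - K" by blast
    have un: "compactin \<tau> (snd p \<union> K)"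
      using p K(1) by (intro compactin_Un) auto
    show "\<exists>q. ?P (Suc n) q \<and> ?Q n p q"
      unfolding split_paired_Ex fst_conv snd_conv
    proof (intro exI conjI impI)
      show "compactin \<tau> K" "compactin \<tau> (snd p \<union> K)" by fact+
      show "snd p \<union> K \<subseteq> E" using p K(2) by blast
      show "measure m (E - (snd p \<union> K)) < 1 / real (Suc (Suc n))"
        unfolding eq by (rule K(3))
      show "K \<inter> snd p = {}" using K(2) by blast
    qed simp_all
  qed
  then obtain p where p': "\<forall>n. ?P n (p n) \<and> ?Q n (p n) (p (Suc n))" ..
  have p: "?P n (p n)" "?Q n (p n) (p (Suc n))" for n
    using p' by blast+
  have mono: "snd (p i) \<subseteq> snd (p j)" if "i \<le> j" for i j
    using that by (rule lift_Suc_mono_le[of "\<lambda>i. snd (p i)", rotated]) (use p(2) in auto)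
  have disj: "fst (p i) \<inter> fst (p j) = {}" if ij: "i < j" for i j
  proof -
    obtain k where k: "j = Suc k" "i \<le> k" using ij by (cases j) auto
    have "fst (p i) \<subseteq> snd (p k)" using p(1)[of i] mono[OF k(2)] by blast
    then show ?thesis using p(2)[of k] k(1) by blast
  qed
  have sub: "snd (p n) \<subseteq> (\<Union>i. fst (p i))" for n
  proof (induction n)
    case 0
    then show ?case using p(1)[of 0] by auto
  next
    case (Suc n)
    then show ?case using p(2)[of n] by auto
  qed
  have [measurable]: "fst (p n) \<in> sets m" for n using p(1)[of n] compactin_sets by blast
  have "measure m (E - (\<Union>i. fst (p i))) \<le> 1 / real (Suc n)" for n
  proof -
    have "measure m (E - (\<Union>i. fst (p i))) \<le> measure m (E - snd (p n))"
      using sub[of n] p(1)[of n] E compactin_sets by (intro finite_measure_mono) auto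
    then show ?thesis using p(1)[of n] by linarith
  qed
  then have "measure m (E - (\<Union>i. fst (p i))) \<le> 0"
    by (intro LIMSEQ_le_const[OF LIMSEQ_Suc[OF lim_1_over_n]]) blast
  then have "emeasure m (E - (\<Union>i. fst (p i))) = 0"
    by (simp add: emeasure_eq_measure measure_le_0_iff)
  moreover have "fst (p n) \<subseteq> E" "compactin \<tau> (fst (p n))" for n
    using p(1)[of n] by blast+
  moreover have "disjoint_family (\<lambda>n. fst (p n))"
    unfolding disjoint_family_on_def using disj by (metis Int_commute linorder_neqE_nat)
  ultimately show ?thesis
    unfolding compact_exhaustion_def by (intro exI[of _ "\<lambda>n. fst (p n)"]) simp
qed

subsection \<open>Restriction to a Borel set\<close>

context
  fixes S :: "'a set" and b :: "('a \<Rightarrow> real) \<Rightarrow> 'a \<Rightarrow> real"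
  assumes S_sets [measurable]: "S \<in> sets m" and local: "local_derivation \<tau> d m b"
begin

lemma S_subset: "S \<subseteq> topspace \<tau>"
  using sets.sets_into_space[OF S_sets] by (simp add: space_m)

lemma topspace_S: "topspace (subtopology \<tau> S) = S"
  using S_subset by auto

lemma ext_distance_S: "ext_distance_on (topspace (subtopology \<tau> S)) d"
  using ext_distance S_subset unfolding topspace_S ext_distance_on_def by (meson subsetD)

lemma derivation: "lipschitz_derivation \<tau> d m b"
  using local by (simp add: local_derivation_def)

lemma b_measurable: "F \<in> Lip_b \<tau> d \<Longrightarrow> b F \<in> borel_measurable m"
  using derivation by (simp add: lipschitz_derivation_def)

text \<open>The Lipschitz bound comes from all of \<open>S\<close>, the size bound only from
  \<open>K\<close>. This suits a difference of two functions that is known to be small on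
  \<open>K\<close> alone.\<close>

lemma extension_from_compact:
  assumes "compactin \<tau> K" "K \<subseteq> S" "0 < L" "0 \<le> M"
    and f: "continuous_map (subtopology \<tau> S) euclideanreal f" "lip_on d L S f"
      "\<And>x. x \<in> K \<Longrightarrow> \<bar>f x\<bar> \<le> M"
  obtains F where "F \<in> Lip_b \<tau> d" "lip_on d L (topspace \<tau>) F"
    "\<And>x. x \<in> topspace \<tau> \<Longrightarrow> \<bar>F x\<bar> \<le> M" "\<And>x. x \<in> K \<Longrightarrow> F x = f x"
proof -
  have "continuous_map (subtopology \<tau> K) euclideanreal f"
    using f(1) assms(2) by (rule continuous_map_from_subtopology_mono)
  moreover have "lip_on d L K f" using f(2) assms(2) by (rule lip_on_subset)
  moreover have "- M \<le> M" "\<And>x. x \<in> K \<Longrightarrow> f x \<in> {- M..M}"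
    using assms(4) f(3) by (auto simp: abs_le_iff minus_le_iff)
  ultimately obtain F where F: "F \<in> Lip_b \<tau> d" "lip_on d L (topspace \<tau>) F"
    "\<And>x. x \<in> topspace \<tau> \<Longrightarrow> F x \<in> {- M..M}" "\<And>x. x \<in> K \<Longrightarrow> F x = f x"
    using Lip_b_extension[OF assms(1,3), of "- M" M f] by metis
  have "\<bar>F x\<bar> \<le> M" if "x \<in> topspace \<tau>" for x
    using F(3)[OF that] by (auto simp: abs_le_iff)
  then show ?thesis using that[OF F(1,2) _ F(4)] by blast
qed

lemma restrict_derivation_choice:
  assumes f: "f \<in> Lip_b (subtopology \<tau> S) d"
  obtains K F where "compact_exhaustion \<tau> m S K" "Lip_b_extensions \<tau> d K f F"
    "restrict_derivation \<tau> d m b S f = (\<lambda>x. \<Sum>n. indicator (K n) x * b (F n) x)"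
proof -
  define K where "K = (SOME K. compact_exhaustion \<tau> m S K)"
  define F where "F = (SOME F. Lip_b_extensions \<tau> d K f F)"
  have K: "compact_exhaustion \<tau> m S K"
    unfolding K_def by (rule someI_ex[OF ex_compact_exhaustion[OF S_sets]])
  obtain L M where LM: "0 < L" "0 < M" "lip_on d L S f" "\<And>x. x \<in> S \<Longrightarrow> \<bar>f x\<bar> \<le> M"
    "continuous_map (subtopology \<tau> S) euclideanreal f"
    using Lip_bE[OF ext_distance_S f] unfolding topspace_S by metis
  have "\<exists>G. G \<in> Lip_b \<tau> d \<and> (\<forall>x\<in>K n. G x = f x)" for n
  proof -
    have Kn: "compactin \<tau> (K n)" "K n \<subseteq> S" using K by (auto simp: compact_exhaustion_def)
    obtain G where "G \<in> Lip_b \<tau> d" "\<And>x. x \<in> K n \<Longrightarrow> G x = f x"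
      by (rule extension_from_compact[OF Kn LM(1) less_imp_le[OF LM(2)] LM(5,3)]) (use LM(4) Kn in auto)
    then show ?thesis by blast
  qed
  then have "\<exists>F. Lip_b_extensions \<tau> d K f F"
    unfolding Lip_b_extensions_def by (intro choice allI)
  then have F: "Lip_b_extensions \<tau> d K f F"
    unfolding F_def by (rule someI_ex)
  show ?thesis
    by (rule that[OF K F]) (simp add: restrict_derivation_def K_def F_def Let_def)
qed

lemma restrict_derivation_measurable:
  assumes "f \<in> Lip_b (subtopology \<tau> S) d"
  shows "restrict_derivation \<tau> d m b S f \<in> borel_measurable m"
proof -
  obtain K F where K: "compact_exhaustion \<tau> m S K" and F: "Lip_b_extensions \<tau> d K f F"
    and eq: "restrict_derivation \<tau> d m b S f = (\<lambda>x. \<Sum>n. indicator (K n) x * b (F n) x)"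
    by (rule restrict_derivation_choice[OF assms])
  have [measurable]: "K n \<in> sets m" "b (F n) \<in> borel_measurable m" for n
    using K F by (auto simp: compact_exhaustion_def Lip_b_extensions_def intro: compactin_sets b_measurable)
  show ?thesis unfolding eq by measurable
qed

text \<open>On each \<open>K n\<close> locality compares the chosen extension with \<open>G\<close>;
  countably many null sets and the uncovered part of \<open>S\<close> are discarded. Later proofs no
  longer inspect the choices in the definition.\<close>

lemma restrict_derivation_AE:
  assumes f: "f \<in> Lip_b (subtopology \<tau> S) d" and G: "G \<in> Lip_b \<tau> d" and A: "A \<subseteq> S"
    and eq: "\<And>x. x \<in> A \<Longrightarrow> G x = f x"
  shows "AE x in m. x \<in> A \<longrightarrow> restrict_derivation \<tau> d m b S f x = b G x"
proof -
  obtain K F where K: "compact_exhaustion \<tau> m S K" and F: "Lip_b_extensions \<tau> d K f F"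
    and rd: "restrict_derivation \<tau> d m b S f = (\<lambda>x. \<Sum>n. indicator (K n) x * b (F n) x)"
    by (rule restrict_derivation_choice[OF f])
  have disj: "disjoint_family K" using K by (simp add: compact_exhaustion_def)
  have on_K: "restrict_derivation \<tau> d m b S f x = b (F n) x" if x: "x \<in> K n" for x n
  proof -
    have "indicator (K k) x = (0::real)" if "k \<noteq> n" for k
      using disjoint_family_onD[OF disj, of k n] that x by (auto simp: indicator_def)
    then have "(\<Sum>k. indicator (K k) x * b (F k) x) = (\<Sum>k\<in>{n}. indicator (K k) x * b (F k) x)"
      by (intro suminf_finite) auto
    then show ?thesis using x by (simp add: rd)
  qed
  have "AE x in m. x \<in> K n \<inter> A \<longrightarrow> b (F n) x = b G x" for n
  proof (rule local_derivation_cong[OF local _ G])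
    show "F n \<in> Lip_b \<tau> d" using F by (simp add: Lip_b_extensions_def)
    show "F n x = G x" if "x \<in> K n \<inter> A" for x
      using F eq that by (auto simp: Lip_b_extensions_def)
  qed
  then have "AE x in m. \<forall>n. x \<in> K n \<inter> A \<longrightarrow> b (F n) x = b G x"
    unfolding AE_all_countable by blast
  moreover have "K n \<in> sets m" for n
    using K by (auto simp: compact_exhaustion_def intro: compactin_sets)
  then have "S - (\<Union>n. K n) \<in> null_sets m"
    using K by (intro null_setsI) (auto simp: compact_exhaustion_def)
  then have "AE x in m. x \<notin> S - (\<Union>n. K n)" by (rule AE_not_in)
  ultimately show ?thesis
  proof eventually_elim
    case (elim x)
    show ?case
    proof
      assume "x \<in> A"
      with elim(2) A obtain n where "x \<in> K n" by blast
      then show "restrict_derivation \<tau> d m b S f x = b G x"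
        using elim(1) \<open>x \<in> A\<close> on_K by simp
    qed
  qed
qed

text \<open>If \<open>F\<close> extends \<open>g\<close> from \<open>K\<close>, then
  \<open>G + F\<close> extends \<open>f\<close>, so additivity of \<open>b\<close> on the whole
  space is enough.\<close>

lemma restrict_derivation_diff_AE:
  assumes f: "f \<in> Lip_b (subtopology \<tau> S) d" and g: "g \<in> Lip_b (subtopology \<tau> S) d"
    and G: "G \<in> Lip_b \<tau> d" and K: "compactin \<tau> K" "K \<subseteq> S"
    and eq: "\<And>x. x \<in> K \<Longrightarrow> G x = f x - g x"
  shows "AE x in m. x \<in> K \<longrightarrow>
    restrict_derivation \<tau> d m b S f x - restrict_derivation \<tau> d m b S g x = b G x"
proof -
  obtain L M where LM: "0 < L" "0 < M" "lip_on d L S g" "\<And>x. x \<in> S \<Longrightarrow> \<bar>g x\<bar> \<le> M"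
    "continuous_map (subtopology \<tau> S) euclideanreal g"
    using Lip_bE[OF ext_distance_S g] unfolding topspace_S by metis
  obtain F where F: "F \<in> Lip_b \<tau> d" "\<And>x. x \<in> K \<Longrightarrow> F x = g x"
    by (rule extension_from_compact[OF K LM(1) less_imp_le[OF LM(2)] LM(5,3)]) (use LM(4) K in auto)
  define H where "H = (\<lambda>x\<in>topspace \<tau>. 1 * G x + 1 * F x)"
  have H: "H \<in> Lip_b \<tau> d" unfolding H_def by (rule Lip_b_lincomb[OF ext_distance G F(1)])
  have "AE x in m. x \<in> K \<longrightarrow> restrict_derivation \<tau> d m b S f x = b H x"
  proof (rule restrict_derivation_AE[OF f H K(2)])
    show "H x = f x" if "x \<in> K" for x
      using that K(2) S_subset eq[OF that] F(2)[OF that] by (auto simp: H_def)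
  qed
  moreover have "AE x in m. x \<in> K \<longrightarrow> restrict_derivation \<tau> d m b S g x = b F x"
    by (rule restrict_derivation_AE[OF g F(1) K(2) F(2)])
  moreover have "AE x in m. b H x = 1 * b G x + 1 * b F x"
    unfolding H_def by (rule derivation_lincomb[OF derivation G F(1)])
  ultimately show ?thesis by eventually_elim simp
qed

text \<open>Extensions from the compact pieces keep both \<open>L\<close> and \<open>M\<close>, so
  the constant of \<open>b\<close> is inherited on every piece and hence almost everywhere on
  \<open>S\<close>.\<close>

lemma restrict_derivation_bound:
  assumes C: "\<And>F L M. F \<in> Lip_b \<tau> d \<Longrightarrow> 0 < L \<Longrightarrow> 0 < M \<Longrightarrow> lip_on d L (topspace \<tau>) F \<Longrightarrow>
    (\<And>x. x \<in> topspace \<tau> \<Longrightarrow> \<bar>F x\<bar> \<le> M) \<Longrightarrow> AE x in m. \<bar>b F x\<bar> \<le> C * (L + M)"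
    and f: "f \<in> Lip_b (subtopology \<tau> S) d" "lip_on d L S f" "\<And>x. x \<in> S \<Longrightarrow> \<bar>f x\<bar> \<le> M"
    and LM: "0 < L" "0 < M"
  shows "AE x in m. x \<in> S \<longrightarrow> \<bar>restrict_derivation \<tau> d m b S f x\<bar> \<le> C * (L + M)"
proof -
  obtain K where K: "compact_exhaustion \<tau> m S K" using ex_compact_exhaustion[OF S_sets] by blast
  have cont: "continuous_map (subtopology \<tau> S) euclideanreal f" using f(1) by (simp add: Lip_b_def)
  have "AE x in m. x \<in> K n \<longrightarrow> \<bar>restrict_derivation \<tau> d m b S f x\<bar> \<le> C * (L + M)" for n
  proof -
    have Kn: "compactin \<tau> (K n)" "K n \<subseteq> S" using K by (auto simp: compact_exhaustion_def)
    obtain G where G: "G \<in> Lip_b \<tau> d" "lip_on d L (topspace \<tau>) G"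
      "\<And>x. x \<in> topspace \<tau> \<Longrightarrow> \<bar>G x\<bar> \<le> M" "\<And>x. x \<in> K n \<Longrightarrow> G x = f x"
      by (rule extension_from_compact[OF Kn LM(1) less_imp_le[OF LM(2)] cont f(2)]) (use f(3) Kn in auto)
    have "AE x in m. x \<in> K n \<longrightarrow> restrict_derivation \<tau> d m b S f x = b G x"
      by (rule restrict_derivation_AE[OF f(1) G(1) Kn(2) G(4)])
    moreover have "AE x in m. \<bar>b G x\<bar> \<le> C * (L + M)"
      by (rule C[OF G(1) LM G(2,3)])
    ultimately show ?thesis by eventually_elim auto
  qed
  then have "AE x in m. \<forall>n. x \<in> K n \<longrightarrow> \<bar>restrict_derivation \<tau> d m b S f x\<bar> \<le> C * (L + M)"
    unfolding AE_all_countable by blast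
  moreover have "K n \<in> sets m" for n
    using K by (auto simp: compact_exhaustion_def intro: compactin_sets)
  then have "S - (\<Union>n. K n) \<in> null_sets m"
    using K by (intro null_setsI) (auto simp: compact_exhaustion_def)
  then have "AE x in m. x \<notin> S - (\<Union>n. K n)" by (rule AE_not_in)
  ultimately show ?thesis by eventually_elim blast
qed

text \<open>Sequential continuity at 0 made quantitative: counterexamples with supremum at most
  \<open>1 / Suc n\<close> and common Lipschitz constant would form a sequence tending to 0. The
  bound \<open>\<epsilon> \<le> 1\<close> keeps the later norm estimates independent of
  \<open>\<epsilon>\<close>.\<close>

lemma uniformly_small_integral:
  assumes seq: "weak_star_seq_continuous \<tau> d m b" and g: "integrable m g" and "0 < L" "0 < \<eta>"
  shows "\<exists>\<epsilon>>0. \<epsilon> \<le> 1 \<and> (\<forall>G\<in>Lip_b \<tau> d. lip_on d L (topspace \<tau>) G \<longrightarrow>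
    (\<forall>x\<in>topspace \<tau>. \<bar>G x\<bar> \<le> \<epsilon>) \<longrightarrow> \<bar>\<integral>x. b G x * g x \<partial>m\<bar> < \<eta>)"
proof (rule ccontr)
  assume no: "\<not> ?thesis"
  have "\<exists>G. G \<in> Lip_b \<tau> d \<and> lip_on d L (topspace \<tau>) G \<and>
      (\<forall>x\<in>topspace \<tau>. \<bar>G x\<bar> \<le> 1 / real (Suc n)) \<and> \<not> \<bar>\<integral>x. b G x * g x \<partial>m\<bar> < \<eta>" for n
  proof (rule ccontr)
    assume "\<not> ?thesis"
    then have "0 < 1 / real (Suc n) \<and> 1 / real (Suc n) \<le> 1 \<and> (\<forall>G\<in>Lip_b \<tau> d. lip_on d L (topspace \<tau>) G \<longrightarrow>
        (\<forall>x\<in>topspace \<tau>. \<bar>G x\<bar> \<le> 1 / real (Suc n)) \<longrightarrow> \<bar>\<integral>x. b G x * g x \<partial>m\<bar> < \<eta>)"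
      by auto
    with no show False by blast
  qed
  from choice[OF allI[OF this]] obtain G where G_all: "\<forall>n. G n \<in> Lip_b \<tau> d \<and> lip_on d L (topspace \<tau>) (G n) \<and>
      (\<forall>x\<in>topspace \<tau>. \<bar>G n x\<bar> \<le> 1 / real (Suc n)) \<and> \<not> \<bar>\<integral>x. b (G n) x * g x \<partial>m\<bar> < \<eta>" ..
  have G: "G n \<in> Lip_b \<tau> d" "lip_on d L (topspace \<tau>) (G n)" "\<not> \<bar>\<integral>x. b (G n) x * g x \<partial>m\<bar> < \<eta>" for n
    using G_all by blast+
  have G_le: "\<bar>G n x\<bar> \<le> 1 / real (Suc n)" if "x \<in> topspace \<tau>" for n x
    using G_all that by blast
  let ?z = "\<lambda>y\<in>topspace \<tau>. 0 :: real"
  have "(\<lambda>n. \<integral>x. b (G n) x * g x \<partial>m) \<longlonglongrightarrow> (\<integral>x. b ?z x * g x \<partial>m)"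
  proof (rule weak_star_seq_continuous_integral[OF derivation seq G(1,2), where M = 1])
    show "?z \<in> Lip_b \<tau> d" by (rule Lip_b_ballD(1)[OF ext_distance zero_in_ball])
    show "lip_on d L (topspace \<tau>) ?z" using \<open>0 < L\<close> by (simp add: lip_on_def)
    show "\<bar>G n x\<bar> \<le> 1" if "x \<in> topspace \<tau>" for n x
      by (rule order_trans[OF G_le[OF that]]) simp
    show "(\<lambda>n. G n x) \<longlonglongrightarrow> ?z x" if "x \<in> topspace \<tau>" for x
    proof (rule Lim_null_comparison[THEN tendsto_eq_rhs])
      show "\<forall>\<^sub>F n in sequentially. norm (G n x) \<le> 1 / real (Suc n)"
        using G_le[OF that] by simp
      show "(\<lambda>n. 1 / real (Suc n)) \<longlonglongrightarrow> 0" by (rule LIMSEQ_Suc[OF lim_1_over_n])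
    qed (use that in simp)
  qed (use \<open>0 < L\<close> g in simp_all)
  also have "(\<integral>x. b ?z x * g x \<partial>m) = 0"
    using derivation_zero[OF derivation] by (intro integral_eq_zero_AE) auto
  finally have "(\<lambda>n. \<bar>\<integral>x. b (G n) x * g x \<partial>m\<bar>) \<longlonglongrightarrow> 0"
    by (rule tendsto_rabs_zero)
  from order_tendstoD(2)[OF this \<open>0 < \<eta>\<close>] show False
    using G(3) by (auto simp: eventually_sequentially)
qed

text \<open>On most of \<open>S\<close> the differences \<open>\<sigma> n - f\<close> are uniformly small (Egorov), hence extend from
  a large compact set to all of \<open>X\<close> with a small bound and a fixed Lipschitz constant.\<close>

lemma restrict_derivation_limit:
  assumes seq: "weak_star_seq_continuous \<tau> d m b"
    and \<sigma>: "\<And>n. \<sigma> n \<in> Lip_b_ball (subtopology \<tau> S) d" and f: "f \<in> Lip_b_ball (subtopology \<tau> S) d"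
    and lim: "\<And>x. x \<in> S \<Longrightarrow> (\<lambda>n. \<sigma> n x) \<longlonglongrightarrow> f x"
    and g: "integrable m g" "\<And>x. x \<notin> S \<Longrightarrow> g x = 0"
  shows "(\<lambda>n. \<integral>x. restrict_derivation \<tau> d m b S (\<sigma> n) x * g x \<partial>m)
    \<longlonglongrightarrow> (\<integral>x. restrict_derivation \<tau> d m b S f x * g x \<partial>m)"
proof (rule LIMSEQ_I)
  fix r :: real assume r: "0 < r"
  let ?B = "restrict_derivation \<tau> d m b S"
  note ball_S = Lip_b_ballD[OF ext_distance_S, unfolded topspace_S]
  have B_meas [measurable]: "?B f \<in> borel_measurable m" "\<And>n. ?B (\<sigma> n) \<in> borel_measurable m"
    using restrict_derivation_measurable ball_S(1) \<sigma> f by blast+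
  have [measurable]: "g \<in> borel_measurable m" using g(1) by simp
  obtain C where C: "0 \<le> C" "\<And>F L M. F \<in> Lip_b \<tau> d \<Longrightarrow> 0 < L \<Longrightarrow> 0 < M \<Longrightarrow> lip_on d L (topspace \<tau>) F \<Longrightarrow>
    (\<And>x. x \<in> topspace \<tau> \<Longrightarrow> \<bar>F x\<bar> \<le> M) \<Longrightarrow> AE x in m. \<bar>b F x\<bar> \<le> C * (L + M)"
    by (rule weak_star_seq_continuous_bounded[OF derivation seq]) blast
  have B_bound: "AE x in m. x \<in> S \<longrightarrow> \<bar>?B h x\<bar> \<le> 2 * C"
    if h: "h \<in> Lip_b_ball (subtopology \<tau> S) d" for h
  proof -
    have "AE x in m. x \<in> S \<longrightarrow> \<bar>?B h x\<bar> \<le> C * (1 + 1)"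
      by (rule restrict_derivation_bound[OF C(2) ball_S(1,2,3)[OF h]]) simp_all
    then show ?thesis by (simp add: mult.commute)
  qed
  have int_B: "integrable m (\<lambda>x. ?B h x * g x)" if h: "h \<in> Lip_b_ball (subtopology \<tau> S) d" for h
  proof (rule Bochner_Integration.integrable_bound)
    show "integrable m (\<lambda>x. 2 * C * g x)" using g(1) by simp
    show "(\<lambda>x. ?B h x * g x) \<in> borel_measurable m"
      using restrict_derivation_measurable[OF ball_S(1)[OF h]] by simp
    show "AE x in m. norm (?B h x * g x) \<le> norm (2 * C * g x)"
      using B_bound[OF h]
    proof eventually_elim
      case (elim x)
      show ?case
      proof (cases "x \<in> S")
        case True
        then show ?thesis using elim C(1) by (auto simp: abs_mult intro!: mult_right_mono)
      qed (simp add: g(2))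
    qed
  qed
  \<comment> \<open>Half of \<open>r\<close> is reserved for the exceptional part of
    \<open>S\<close>. There the terms are bounded by \<open>2 * C\<close>, \<open>2 * C\<close> and
    \<open>3 * C\<close>, which gives 7; the summand 1 covers \<open>C = 0\<close>.\<close>
  define \<eta> where "\<eta> = r / (2 * (7 * C + 1))"
  have \<eta>: "0 < \<eta>" using r C(1) by (simp add: \<eta>_def)
  obtain \<epsilon> where \<epsilon>: "0 < \<epsilon>" "\<epsilon> \<le> 1" "\<And>G. G \<in> Lip_b \<tau> d \<Longrightarrow> lip_on d 2 (topspace \<tau>) G \<Longrightarrow>
      (\<And>x. x \<in> topspace \<tau> \<Longrightarrow> \<bar>G x\<bar> \<le> \<epsilon>) \<Longrightarrow> \<bar>\<integral>x. b G x * g x \<partial>m\<bar> < r / 2"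
    using uniformly_small_integral[OF seq g(1), of 2 "r / 2"] r by auto
  obtain \<delta> where \<delta>: "0 < \<delta>" "\<And>A. A \<in> sets m \<Longrightarrow> measure m A < \<delta> \<Longrightarrow> (\<integral>x. indicator A x * \<bar>g x\<bar> \<partial>m) < \<eta>"
    using integral_absolutely_continuous[OF g(1) \<eta>] by (auto simp: emeasure_eq_measure)
  have cont: "continuous_map (subtopology \<tau> S) euclideanreal (\<lambda>x. \<sigma> n x - f x)" for n
    using ball_S(1)[OF \<sigma>[of n]] ball_S(1)[OF f] by (intro continuous_map_diff) (simp_all add: Lip_b_def)
  have lip: "lip_on d 2 S (\<lambda>x. \<sigma> n x - f x)" for n
    using lip_on_diff[OF ball_S(2)[OF \<sigma>[of n]] ball_S(2)[OF f]] by simp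
  define U where "U j = {x \<in> S. \<epsilon> < \<bar>\<sigma> j x - f x\<bar>}" for j
  \<comment> \<open>One tolerance \<open>\<epsilon>\<close> suffices, so a single level of the
    Egorov argument is enough: the sets \<open>V N\<close> decrease to the empty set, hence their
    measures tend to 0.\<close>
  define V where "V N = (\<Union>j\<in>{N..}. U j)" for N
  have U_sets: "U j \<in> sets m" for j
  proof -
    have "continuous_map (subtopology \<tau> S) euclideanreal (\<lambda>x. \<bar>\<sigma> j x - f x\<bar>)"
      by (rule continuous_map_real_abs[OF cont])
    from openin_continuous_map_preimage[OF this, of "{\<epsilon><..}"]
    have "openin (subtopology \<tau> S) (U j)" unfolding U_def topspace_S by simp
    then obtain T where "openin \<tau> T" "U j = T \<inter> S" by (auto simp: openin_subtopology)
    then show ?thesis using openin_sets S_sets by auto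
  qed
  have V_sets: "V N \<in> sets m" for N unfolding V_def using U_sets by auto
  have "(\<Inter>N. V N) = {}"
  proof -
    have "\<exists>N. x \<notin> V N" for x
    proof (cases "x \<in> S")
      case True
      have "\<forall>\<^sub>F j in sequentially. dist (\<sigma> j x) (f x) < \<epsilon>"
        using lim[OF True] \<epsilon>(1) by (rule tendstoD)
      then obtain N where "\<And>j. N \<le> j \<Longrightarrow> dist (\<sigma> j x) (f x) < \<epsilon>"
        unfolding eventually_sequentially by blast
      then have "x \<notin> V N" by (force simp: V_def U_def dist_real_def)
      then show ?thesis ..
    qed (auto simp: V_def U_def)
    then show ?thesis by auto
  qed
  moreover have "decseq V" by (force simp: decseq_def V_def)
  ultimately have "(\<lambda>N. measure m (V N)) \<longlonglongrightarrow> 0"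
    using finite_Lim_measure_decseq[of V] V_sets by auto
  then have "\<forall>\<^sub>F N in sequentially. measure m (V N) < \<delta> / 2"
    using \<delta>(1) by (intro order_tendstoD(2)[of _ 0]) auto
  then obtain N where N: "measure m (V N) < \<delta> / 2" by (auto simp: eventually_sequentially)
  have SV: "S - V N \<in> sets m" using S_sets V_sets by blast
  obtain K where K: "compactin \<tau> K" "K \<subseteq> S - V N" "measure m (S - V N - K) < \<delta> / 2"
    using ex_compact_approx[OF SV, of "\<delta> / 2"] \<delta>(1) by auto
  have K_sets: "K \<in> sets m" using compactin_sets[OF K(1)] .
  have "measure m (S - K) \<le> measure m (V N \<union> (S - V N - K))"
    using V_sets SV K_sets by (intro finite_measure_mono) auto
  also have "\<dots> \<le> measure m (V N) + measure m (S - V N - K)"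
    using V_sets SV K_sets by (intro measure_Un_le) auto
  finally have "measure m (S - K) < \<delta>" using N K(3) by linarith
  then have rest: "(\<integral>x. indicator (S - K) x * \<bar>g x\<bar> \<partial>m) < \<eta>"
    using S_sets K_sets by (intro \<delta>(2)) auto
  have "integrable m (\<lambda>x. indicator (S - K) x *\<^sub>R \<bar>g x\<bar>)"
    using S_sets K_sets g(1) by (intro integrable_mult_indicator) auto
  then have int_rest: "integrable m (\<lambda>x. 7 * C * (indicator (S - K) x * \<bar>g x\<bar>))" by simp
  have "norm ((\<integral>x. ?B (\<sigma> n) x * g x \<partial>m) - (\<integral>x. ?B f x * g x \<partial>m)) < r" if n: "N \<le> n" for n
  proof -
    have KS: "K \<subseteq> S" using K(2) by blast
    have small: "\<bar>\<sigma> n x - f x\<bar> \<le> \<epsilon>" if "x \<in> K" for x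
      using that K(2) n by (force simp: V_def U_def)
    obtain G where G: "G \<in> Lip_b \<tau> d" "lip_on d 2 (topspace \<tau>) G"
      "\<And>x. x \<in> topspace \<tau> \<Longrightarrow> \<bar>G x\<bar> \<le> \<epsilon>" "\<And>x. x \<in> K \<Longrightarrow> G x = \<sigma> n x - f x"
      by (rule extension_from_compact[OF K(1) KS _ _ cont lip small]) (use \<epsilon> in auto)
    have "b G \<in> L_infinity m" using seq G(1) by (simp add: weak_star_seq_continuous_def)
    then have int_G: "integrable m (\<lambda>x. b G x * g x)" by (rule L_infinity_integrable[OF _ g(1)])
    have G_bound: "AE x in m. \<bar>b G x\<bar> \<le> C * (2 + \<epsilon>)"
      by (rule C(2)[OF G(1) _ \<epsilon>(1) G(2,3)]) simp_all
    have diff: "AE x in m. x \<in> K \<longrightarrow> ?B (\<sigma> n) x - ?B f x = b G x"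
      by (rule restrict_derivation_diff_AE[OF ball_S(1)[OF \<sigma>] ball_S(1)[OF f] G(1) K(1) KS G(4)])
    have C3: "C * (2 + \<epsilon>) \<le> 3 * C" using \<epsilon>(2) C(1) mult_left_mono[of "2 + \<epsilon>" 3 C] by simp
    \<comment> \<open>Almost everywhere zero on \<open>K\<close>, where \<open>G\<close> extends the
      difference, and zero off \<open>S\<close>, where \<open>g\<close> vanishes; only
      \<open>S - K\<close> contributes. The integral of \<open>b G x * g x\<close> is small by the
      choice of \<open>\<epsilon>\<close>.\<close>
    let ?D = "\<lambda>x. (?B (\<sigma> n) x * g x - ?B f x * g x) - b G x * g x"
    have int_D: "integrable m (\<lambda>x. ?B (\<sigma> n) x * g x - ?B f x * g x)"
      using int_B[OF \<sigma>] int_B[OF f] by (rule Bochner_Integration.integrable_diff)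
    have int_DG: "integrable m ?D"
      using int_D int_G by (rule Bochner_Integration.integrable_diff)
    have "norm (\<integral>x. ?D x \<partial>m) \<le> (\<integral>x. norm (?D x) \<partial>m)" by (rule integral_norm_bound)
    also have "\<dots> \<le> (\<integral>x. 7 * C * (indicator (S - K) x * \<bar>g x\<bar>) \<partial>m)"
    proof (rule integral_mono_AE[OF integrable_norm[OF int_DG] int_rest])
      show "AE x in m. norm (?D x) \<le> 7 * C * (indicator (S - K) x * \<bar>g x\<bar>)"
        using diff B_bound[OF \<sigma>[of n]] B_bound[OF f] G_bound
      proof eventually_elim
        case (elim x)
        have D: "?D x = (?B (\<sigma> n) x - ?B f x - b G x) * g x" by (simp add: algebra_simps)
        consider "x \<in> K" | "x \<in> S - K" | "x \<notin> S" by blast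
        then show ?case
        proof cases
          case 1
          then show ?thesis unfolding D using elim(1) by simp
        next
          case 2
          then have "\<bar>?B (\<sigma> n) x\<bar> \<le> 2 * C" "\<bar>?B f x\<bar> \<le> 2 * C" using elim(2,3) by simp_all
          then have "\<bar>?B (\<sigma> n) x - ?B f x - b G x\<bar> \<le> 7 * C" using elim(4) C3 by linarith
          then show ?thesis unfolding D using 2 by (simp add: abs_mult mult_right_mono)
        next
          case 3
          then show ?thesis using g(2) by simp
        qed
      qed
    qed
    also have "\<dots> = 7 * C * (\<integral>x. indicator (S - K) x * \<bar>g x\<bar> \<partial>m)" by simp
    also have "\<dots> \<le> 7 * C * \<eta>"
      using rest C(1) by (intro mult_left_mono) auto
    also have "\<dots> \<le> r / 2"
    proof -
      have "7 * C * \<eta> \<le> (7 * C + 1) * \<eta>" using \<eta> by (simp add: algebra_simps)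
      also have "\<dots> = r / 2" using C(1) by (simp add: \<eta>_def divide_simps)
      finally show ?thesis .
    qed
    finally have "\<bar>\<integral>x. ?D x \<partial>m\<bar> \<le> r / 2" by simp
    moreover have "(\<integral>x. ?D x \<partial>m) = (\<integral>x. ?B (\<sigma> n) x * g x \<partial>m) - (\<integral>x. ?B f x * g x \<partial>m) - (\<integral>x. b G x * g x \<partial>m)"
      using Bochner_Integration.integral_diff[OF int_D int_G]
        Bochner_Integration.integral_diff[OF int_B[OF \<sigma>] int_B[OF f]] by simp
    moreover have "\<bar>\<integral>x. b G x * g x \<partial>m\<bar> < r / 2" by (rule \<epsilon>(3)[OF G(1,2,3)])
    ultimately show ?thesis unfolding real_norm_def by linarith
  qed
  then show "\<exists>no. \<forall>n\<ge>no. norm ((\<integral>x. ?B (\<sigma> n) x * g x \<partial>m) - (\<integral>x. ?B f x * g x \<partial>m)) < r" by blast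
qed

text \<open>Integrals over the restricted measure are integrals over \<open>m\<close> against test
  functions extended by 0, the form in which the limit was established. Values in
  \<open>L_infinity\<close> come from the common bound on \<open>b\<close>.\<close>

lemma restrict_derivation_seq_continuous:
  assumes seq: "weak_star_seq_continuous \<tau> d m b"
  shows "weak_star_seq_continuous (subtopology \<tau> S) d (restrict_space m S) (restrict_derivation \<tau> d m b S)"
proof -
  let ?B = "restrict_derivation \<tau> d m b S"
  have S': "S \<inter> space m \<in> sets m" by measurable
  obtain C where C: "0 \<le> C" "\<And>F L M. F \<in> Lip_b \<tau> d \<Longrightarrow> 0 < L \<Longrightarrow> 0 < M \<Longrightarrow> lip_on d L (topspace \<tau>) F \<Longrightarrow>
    (\<And>x. x \<in> topspace \<tau> \<Longrightarrow> \<bar>F x\<bar> \<le> M) \<Longrightarrow> AE x in m. \<bar>b F x\<bar> \<le> C * (L + M)"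
    by (rule weak_star_seq_continuous_bounded[OF derivation seq]) blast
  have Linf: "?B f \<in> L_infinity (restrict_space m S)" if f: "f \<in> Lip_b (subtopology \<tau> S) d" for f
  proof -
    obtain L M where LM: "0 < L" "0 < M" "lip_on d L S f" "\<And>x. x \<in> S \<Longrightarrow> \<bar>f x\<bar> \<le> M"
      using Lip_bE[OF ext_distance_S f] unfolding topspace_S by metis
    have "AE x in m. x \<in> S \<longrightarrow> \<bar>?B f x\<bar> \<le> C * (L + M)"
      by (rule restrict_derivation_bound[OF C(2) f LM(3,4,1,2)])
    then have "AE x in restrict_space m S. \<bar>?B f x\<bar> \<le> C * (L + M)"
      by (simp add: AE_restrict_space_iff[OF S'])
    moreover have "?B f \<in> borel_measurable (restrict_space m S)"
      using restrict_derivation_measurable[OF f] by (rule measurable_restrict_space1)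
    ultimately show ?thesis unfolding L_infinity_def by blast
  qed
  have "limitin (weak_star_topology (restrict_space m S)) (?B \<circ> \<sigma>) (?B f) sequentially"
    if \<sigma>: "range \<sigma> \<subseteq> Lip_b_ball (subtopology \<tau> S) d"
      and lim: "limitin (ball_pointwise_topology (subtopology \<tau> S) d) \<sigma> f sequentially" for \<sigma> f
    unfolding limitin_weak_star_iff
  proof (intro conjI allI impI)
    have f: "f \<in> Lip_b_ball (subtopology \<tau> S) d" and pw: "\<And>x. x \<in> S \<Longrightarrow> (\<lambda>n. \<sigma> n x) \<longlonglongrightarrow> f x"
      using lim unfolding limitin_ball_pointwise_iff topspace_S by blast+
    have \<sigma>': "\<sigma> n \<in> Lip_b_ball (subtopology \<tau> S) d" for n using \<sigma> by blast
    show "?B f \<in> L_infinity (restrict_space m S)"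
      using f by (intro Linf Lip_b_ballD(1)[OF ext_distance_S])
    show "\<forall>\<^sub>F n in sequentially. (?B \<circ> \<sigma>) n \<in> L_infinity (restrict_space m S)"
      using Linf[OF Lip_b_ballD(1)[OF ext_distance_S \<sigma>']] by simp
    fix g :: "'a \<Rightarrow> real" assume g: "integrable (restrict_space m S) g"
    have "integrable m (\<lambda>x. indicator S x * g x)"
      using g by (simp add: integrable_restrict_space[OF S'])
    from restrict_derivation_limit[OF seq \<sigma>' f pw this]
    have "(\<lambda>n. \<integral>x. ?B (\<sigma> n) x * (indicator S x * g x) \<partial>m) \<longlonglongrightarrow> (\<integral>x. ?B f x * (indicator S x * g x) \<partial>m)"
      by simp
    then show "(\<lambda>n. \<integral>x. (?B \<circ> \<sigma>) n x * g x \<partial>restrict_space m S)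
        \<longlonglongrightarrow> (\<integral>x. ?B f x * g x \<partial>restrict_space m S)"
      by (simp add: integral_restrict_space[OF S'] mult.left_commute)
  qed
  then show ?thesis
    unfolding weak_star_seq_continuous_def using Linf by blast
qed

end

end

theorem proposition4p7:
  fixes \<tau> :: "'a topology" and d :: "'a \<Rightarrow> 'a \<Rightarrow> ennreal" and m :: "'a measure"
    and S :: "'a set" and b :: "('a \<Rightarrow> real) \<Rightarrow> ('a \<Rightarrow> real)"
  assumes "emtm_space \<tau> d m"
    and "maximal_separable_component d m S"
    and "lipschitz_derivation \<tau> d m b"
  shows
    "(weak_star_continuous \<tau> d m b \<longrightarrow>
        (\<forall>f\<in>Lip_b \<tau> d. AE x in m. x \<in> topspace \<tau> - S \<longrightarrow> b f x = 0)) \<and>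
     (local_derivation \<tau> d m b \<and>
        weak_star_seq_continuous (subtopology \<tau> S) d (restrict_space m S)
          (restrict_derivation \<tau> d m b S) \<longrightarrow>
        weak_star_continuous (subtopology \<tau> S) d (restrict_space m S)
          (restrict_derivation \<tau> d m b S)) \<and>
     (weak_star_seq_continuous \<tau> d m b \<longrightarrow>
        weak_star_continuous (subtopology \<tau> S) d (restrict_space m S)
          (restrict_derivation \<tau> d m b S))"
proof (intro conjI impI ballI)
  interpret emtm \<tau> d m
    using assms(1) by unfold_locales (simp_all add: emtm_space_def)
  have S: "S \<in> sets m" "d_separable d S"
    using assms(2) by (simp_all add: maximal_separable_component_def)
  have S_top: "topspace (subtopology \<tau> S) = S"
    using sets.sets_into_space[OF S(1)] by (auto simp: space_m)
  have "ext_distance_on (topspace (subtopology \<tau> S)) d"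
    using ext_distance sets.sets_into_space[OF S(1)] unfolding S_top space_m ext_distance_on_def
    by (meson subsetD)
  from weak_star_seq_continuous_imp_continuous[OF this, unfolded S_top, OF S(2)]
  have upgrade: "weak_star_continuous (subtopology \<tau> S) d (restrict_space m S) (restrict_derivation \<tau> d m b S)"
    if "weak_star_seq_continuous (subtopology \<tau> S) d (restrict_space m S) (restrict_derivation \<tau> d m b S)"
    using that .
  show "AE x in m. x \<in> topspace \<tau> - S \<longrightarrow> b f x = 0"
    if "weak_star_continuous \<tau> d m b" "f \<in> Lip_b \<tau> d" for f
    using weak_star_continuous_derivation_vanishes[OF assms(2,3) that] .
  show "weak_star_continuous (subtopology \<tau> S) d (restrict_space m S) (restrict_derivation \<tau> d m b S)"
    if "local_derivation \<tau> d m b \<and>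
      weak_star_seq_continuous (subtopology \<tau> S) d (restrict_space m S) (restrict_derivation \<tau> d m b S)"
    using that upgrade by blast
  show "weak_star_continuous (subtopology \<tau> S) d (restrict_space m S) (restrict_derivation \<tau> d m b S)"
    if seq: "weak_star_seq_continuous \<tau> d m b"
    \<comment> \<open>Locality is derived first: the facts about the restricted derivation are
      stated for local \<open>b\<close>.\<close>
    using restrict_derivation_seq_continuous[OF S(1) weak_star_seq_continuous_imp_local[OF assms(3) seq] seq]
    by (rule upgrade)
qed

end
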